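(* Let $W$ be an NDCSE with respect to a closed abelian subgroup $H\subseteq G$. Then the measurement channel is $$\mathcal M_W=\sum_{\lambda} a_\lambda^H\,\mathcal P^{\mathcal D}_\lambda,\qquad a_\lambda^H=\frac{d_\lambda^H}{d_\lambda},$$ where the sum is over the irreducible representations $\lambda$ of $G$ occurring in $\mathcal L^{\mathcal D}$, $\mathcal P^{\mathcal D}_\lambda$ is the Hilbert–Schmidt orthogonal projector onto the $\lambda$-isotypic component $\mathcal L^{\mathcal D}_\lambda$ of $\mathcal L^{\mathcal D}$, $d_\lambda=\dim V^\lambda$, and $d^H_\lambda$ is the dimension of the subspace of $V^\lambda$ fixed by $H$. Consequently $W$ is centralizing, the visible space is $\mathrm{Im}(\mathcal M_W)=\bigoplus_{\lambda:\,a^H_\lambda>0}\mathcal L^{\mathcal D}_\lambda$, and on it $\mathcal M_W^{-1}=\sum_{\lambda:a^H_\lambda>0}(a_\lambda^H)^{-1}\mathcal P^{\mathcal D}_\lambda$.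
   Context: Standing setting: $G$ compact group with normalized Haar measure, $R:G\to\mathsf U(\mathcal H)$ continuous unitary representation on a finite-dimensional Hilbert space $\mathcal H$; $\mathcal L=\mathrm{End}(\mathcal H)$ with Hilbert–Schmidt inner product and $G$-action $g\cdot X=R(g)XR(g)^\dagger$. For an orthonormal basis $W$ of $\mathcal H$: $\mathcal A_W(X)=\sum_w\langle w|X|w\rangle|w\rangle\langle w|$ and the measurement channel $\mathcal M_W(X)=\int_G R(g)^\dagger\mathcal A_W(R(g)XR(g)^\dagger)R(g)\,dg$. Fourier basis (FB): orthonormal basis $W$ with a decomposition $\mathcal H=\bigoplus_{\eta,i}\mathcal H^{\eta,i}$ into irreducible $G$-submodules, $W=\bigcup W^{\eta,i}$, $W^{\eta,i}$ an orthonormal basis of $\mathcal H^{\eta,i}$; $\mathcal L^{\mathcal D}=\bigoplus_{\eta,i}\mathrm{End}(\mathcal H^{\eta,i})$ (a $G$-submodule of $\mathcal L$). CSE w.r.t. an abelian subgroup $H$: an FB whose elements are simultaneous eigenvectors of all $R(h)$, $h\in H$; NDCSE: additionally each $\mathcal H^{\eta,i}$ restricted to $H$ is multiplicity-free. A basis is centralizing if $\mathcal M_W$ acts as a scalar on each isotypic component of $\mathrm{Im}(\mathcal M_W)$. *)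

theory Defs
  imports "HOL-Probability.Probability" "HOL-Algebra.Group"
begin

section \<open>Compact groups and normalized Haar measure\<close>

definition borel_of :: "'a topology \<Rightarrow> 'a measure" where
  "borel_of T = sigma (topspace T) {U. openin T U}"

definition compact_group :: "('g, 'b) monoid_scheme \<Rightarrow> 'g topology \<Rightarrow> bool" where
  "compact_group G T \<longleftrightarrow> group G \<and> topspace T = carrier G \<and> compact_space T \<and> Hausdorff_space T
     \<and> continuous_map (prod_topology T T) T (\<lambda>(x, y). x \<otimes>\<^bsub>G\<^esub> y)
     \<and> continuous_map T T (\<lambda>x. inv\<^bsub>G\<^esub> x)"

text \<open>Normalized Haar measure: a (left and right) translation invariant Borel probability measure.\<close>
definition haar_prob :: "('g, 'b) monoid_scheme \<Rightarrow> 'g topology \<Rightarrow> 'g measure \<Rightarrow> bool" where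
  "haar_prob G T \<mu> \<longleftrightarrow> prob_space \<mu> \<and> space \<mu> = carrier G \<and> sets \<mu> = sets (borel_of T)
     \<and> (\<forall>g\<in>carrier G. \<forall>A\<in>sets \<mu>.
          emeasure \<mu> ((\<lambda>x. g \<otimes>\<^bsub>G\<^esub> x) ` A) = emeasure \<mu> A
        \<and> emeasure \<mu> ((\<lambda>x. x \<otimes>\<^bsub>G\<^esub> g) ` A) = emeasure \<mu> A)"

section \<open>Linear algebra on H = complex^'n and L = End(H) = complex^'n^'n\<close>

definition adj :: "complex^'n^'n \<Rightarrow> complex^'n^'n" where
  "adj A = (\<chi> i j. cnj (A $ j $ i))"

definition cinner :: "complex^'n \<Rightarrow> complex^'n \<Rightarrow> complex" where
  "cinner u v = (\<Sum>i\<in>UNIV. cnj (u $ i) * v $ i)"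

definition ket_bra :: "complex^'n \<Rightarrow> complex^'n \<Rightarrow> complex^'n^'n" where
  "ket_bra u v = (\<chi> i j. u $ i * cnj (v $ j))"

text \<open>Complex scalar multiplication on operators.\<close>
definition cscale :: "complex \<Rightarrow> complex^'n^'n \<Rightarrow> complex^'n^'n" where
  "cscale c A = (\<chi> i j. c * A $ i $ j)"

text \<open>Hilbert--Schmidt inner product.\<close>
definition hs_inner :: "complex^'n^'n \<Rightarrow> complex^'n^'n \<Rightarrow> complex" where
  "hs_inner X Y = trace (adj X ** Y)"

text \<open>Hilbert--Schmidt orthogonal projector onto a (complex) subspace S of L.\<close>
definition hs_proj :: "(complex^'n^'n) set \<Rightarrow> complex^'n^'n \<Rightarrow> complex^'n^'n" where
  "hs_proj S X = (THE Y. Y \<in> S \<and> (\<forall>Z\<in>S. hs_inner Z (X - Y) = 0))"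

definition unitary :: "complex^'n^'n \<Rightarrow> bool" where
  "unitary U \<longleftrightarrow> adj U ** U = mat 1 \<and> U ** adj U = mat 1"

text \<open>Complex dimension, w.r.t. a complex scalar multiplication sc.\<close>
abbreviation cdim where "cdim sc S \<equiv> vector_space.dim sc S"

section \<open>Representations (generic over the scalar multiplication sc of the space)\<close>

definition invariant_sub ::
  "(complex \<Rightarrow> 'v::ab_group_add \<Rightarrow> 'v) \<Rightarrow> 'g set \<Rightarrow> ('g \<Rightarrow> 'v \<Rightarrow> 'v) \<Rightarrow> 'v set \<Rightarrow> 'v set \<Rightarrow> bool" where
  "invariant_sub sc Gc act V U \<longleftrightarrow> module.subspace sc U \<and> U \<subseteq> V
      \<and> (\<forall>g\<in>Gc. \<forall>x\<in>U. act g x \<in> U)"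

definition irred_sub ::
  "(complex \<Rightarrow> 'v::ab_group_add \<Rightarrow> 'v) \<Rightarrow> 'g set \<Rightarrow> ('g \<Rightarrow> 'v \<Rightarrow> 'v) \<Rightarrow> 'v set \<Rightarrow> 'v set \<Rightarrow> bool" where
  "irred_sub sc Gc act V U \<longleftrightarrow> invariant_sub sc Gc act V U \<and> U \<noteq> {0}
      \<and> (\<forall>U'. invariant_sub sc Gc act V U' \<and> U' \<subseteq> U \<longrightarrow> U' = {0} \<or> U' = U)"

definition iso_sub ::
  "(complex \<Rightarrow> 'v::ab_group_add \<Rightarrow> 'v) \<Rightarrow> 'g set \<Rightarrow> ('g \<Rightarrow> 'v \<Rightarrow> 'v) \<Rightarrow> 'v set \<Rightarrow> 'v set \<Rightarrow> bool" where
  "iso_sub sc Gc act U U' \<longleftrightarrow> (\<exists>f. Vector_Spaces.linear sc sc f \<and> bij_betw f U U'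
      \<and> (\<forall>g\<in>Gc. \<forall>x\<in>U. f (act g x) = act g (f x)))"

text \<open>The isotypic component of V of the isomorphism type of the irreducible submodule U.\<close>
definition iso_comp ::
  "(complex \<Rightarrow> 'v::ab_group_add \<Rightarrow> 'v) \<Rightarrow> 'g set \<Rightarrow> ('g \<Rightarrow> 'v \<Rightarrow> 'v) \<Rightarrow> 'v set \<Rightarrow> 'v set \<Rightarrow> 'v set" where
  "iso_comp sc Gc act V U =
     module.span sc (\<Union>{U'. irred_sub sc Gc act V U' \<and> iso_sub sc Gc act U U'})"

text \<open>The set of isotypic components of V (one for each irreducible type occurring in V).\<close>
definition isotypics ::
  "(complex \<Rightarrow> 'v::ab_group_add \<Rightarrow> 'v) \<Rightarrow> 'g set \<Rightarrow> ('g \<Rightarrow> 'v \<Rightarrow> 'v) \<Rightarrow> 'v set \<Rightarrow> 'v set set" where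
  "isotypics sc Gc act V = iso_comp sc Gc act V ` {U. irred_sub sc Gc act V U}"

section \<open>The setting\<close>

definition cont_unitary_rep ::
  "('g, 'b) monoid_scheme \<Rightarrow> 'g topology \<Rightarrow> ('g \<Rightarrow> complex^'n^'n) \<Rightarrow> bool" where
  "cont_unitary_rep G T R \<longleftrightarrow> continuous_map T euclidean R
     \<and> (\<forall>g\<in>carrier G. unitary (R g))
     \<and> (\<forall>g\<in>carrier G. \<forall>h\<in>carrier G. R (g \<otimes>\<^bsub>G\<^esub> h) = R g ** R h)"

text \<open>Action on H and on L.\<close>
definition hact :: "('g \<Rightarrow> complex^'n^'n) \<Rightarrow> 'g \<Rightarrow> complex^'n \<Rightarrow> complex^'n" where
  "hact R g v = R g *v v"

definition lact :: "('g \<Rightarrow> complex^'n^'n) \<Rightarrow> 'g \<Rightarrow> complex^'n^'n \<Rightarrow> complex^'n^'n" where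
  "lact R g X = R g ** X ** adj (R g)"

definition onb :: "(complex^'n) set \<Rightarrow> bool" where
  "onb W \<longleftrightarrow> (\<forall>w\<in>W. \<forall>w'\<in>W. cinner w w' = (if w = w' then 1 else 0))
     \<and> module.span (*s) W = UNIV"

text \<open>Fourier basis: W is an orthonormal basis, partitioned into blocks Ws, each block spanning
  an irreducible G-submodule of H (hence an orthonormal basis of it).\<close>
definition fourier_basis ::
  "('g, 'b) monoid_scheme \<Rightarrow> ('g \<Rightarrow> complex^'n^'n) \<Rightarrow> (complex^'n) set \<Rightarrow> (complex^'n) set set \<Rightarrow> bool" where
  "fourier_basis G R W Ws \<longleftrightarrow> onb W \<and> \<Union>Ws = W
     \<and> (\<forall>B\<in>Ws. \<forall>B'\<in>Ws. B \<noteq> B' \<longrightarrow> B \<inter> B' = {})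
     \<and> (\<forall>B\<in>Ws. irred_sub (*s) (carrier G) (hact R) UNIV (module.span (*s) B))"

text \<open>L^D = direct sum of End(H^{eta,i}), viewed inside L.\<close>
definition LD :: "(complex^'n) set set \<Rightarrow> (complex^'n^'n) set" where
  "LD Ws = module.span cscale {ket_bra w w' | w w' B. B \<in> Ws \<and> w \<in> B \<and> w' \<in> B}"

definition CSE ::
  "('g, 'b) monoid_scheme \<Rightarrow> ('g \<Rightarrow> complex^'n^'n) \<Rightarrow> 'g set \<Rightarrow> (complex^'n) set \<Rightarrow> (complex^'n) set set \<Rightarrow> bool" where
  "CSE G R H W Ws \<longleftrightarrow> fourier_basis G R W Ws
     \<and> (\<forall>w\<in>W. \<forall>h\<in>H. \<exists>c. R h *v w = c *s w)"

text \<open>Restriction to the abelian group H of each block is multiplicity free: every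
  joint eigenspace (weight space of a character chi of H) inside the block has dimension at most 1.\<close>
definition NDCSE ::
  "('g, 'b) monoid_scheme \<Rightarrow> ('g \<Rightarrow> complex^'n^'n) \<Rightarrow> 'g set \<Rightarrow> (complex^'n) set \<Rightarrow> (complex^'n) set set \<Rightarrow> bool" where
  "NDCSE G R H W Ws \<longleftrightarrow> CSE G R H W Ws
     \<and> (\<forall>B\<in>Ws. \<forall>chr::'g \<Rightarrow> complex.
          cdim (*s) {v \<in> module.span (*s) B. \<forall>h\<in>H. R h *v v = chr h *s v} \<le> 1)"

section \<open>Measurement channel\<close>

definition dephase :: "(complex^'n) set \<Rightarrow> complex^'n^'n \<Rightarrow> complex^'n^'n" where
  "dephase W X = (\<Sum>w\<in>W. cscale (cinner w (X *v w)) (ket_bra w w))"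

definition meas_channel ::
  "'g measure \<Rightarrow> ('g \<Rightarrow> complex^'n^'n) \<Rightarrow> (complex^'n) set \<Rightarrow> complex^'n^'n \<Rightarrow> complex^'n^'n" where
  "meas_channel \<mu> R W X = (\<integral>g. adj (R g) ** dephase W (R g ** X ** adj (R g)) ** R g \<partial>\<mu>)"

text \<open>Centralizing: M acts as a scalar on each isotypic component of Im(M).\<close>
definition centralizing ::
  "('g, 'b) monoid_scheme \<Rightarrow> 'g measure \<Rightarrow> ('g \<Rightarrow> complex^'n^'n) \<Rightarrow> (complex^'n) set \<Rightarrow> bool" where
  "centralizing G \<mu> R W \<longleftrightarrow>
     (\<forall>C\<in>isotypics cscale (carrier G) (lact R) (range (meas_channel \<mu> R W)).
        \<exists>c. \<forall>X\<in>C. meas_channel \<mu> R W X = cscale c X)"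

text \<open>The coefficient a^H_lambda = d^H_lambda / d_lambda of an isotypic component C of L^D,
  computed from an irreducible submodule U of L^D of type lambda (U is isomorphic to V^lambda).\<close>
definition coeffH ::
  "('g, 'b) monoid_scheme \<Rightarrow> ('g \<Rightarrow> complex^'n^'n) \<Rightarrow> 'g set \<Rightarrow> (complex^'n) set set
     \<Rightarrow> (complex^'n^'n) set \<Rightarrow> real" where
  "coeffH G R H Ws C =
     (let U = (SOME U. irred_sub cscale (carrier G) (lact R) (LD Ws) U
                    \<and> iso_comp cscale (carrier G) (lact R) (LD Ws) U = C)
      in real (cdim cscale {X \<in> U. \<forall>h\<in>H. lact R h X = X}) / real (cdim cscale U))"

end

theory Submission
  imports Defs "HOL-Computational_Algebra.Fundamental_Theorem_Algebra"
begin

text \<open>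
  In an NDCSE the operators \<open>|w\<rangle>\<langle>w'|\<close> with \<open>w, w'\<close> in one block are weight vectors of \<open>H\<close>, and the weight is
  trivial only for \<open>w = w'\<close>; hence dephasing is the orthogonal projector onto the \<open>H\<close>-fixed vectors of
  \<open>L\<^sup>D\<close>. It therefore maps every \<open>G\<close>-submodule \<open>U\<close> of \<open>L\<^sup>D\<close> to itself, and so does its \<open>G\<close>-average, the
  measurement channel. The latter is an intertwiner, so by Schur it is a scalar on irreducible \<open>U\<close>; as
  averaging preserves the trace over \<open>U\<close>, this scalar is \<open>dim U\<^sup>H / dim U\<close>. Finally \<open>L\<^sup>D\<close> is the orthogonal
  sum of its isotypic components, and the channel vanishes on the orthogonal complement of \<open>L\<^sup>D\<close>.
\<close>

section \<open>The Hilbert--Schmidt space\<close>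

text \<open>Two choices shape the argument. The channel is an operator-valued integral, so it is
  treated through its scalar pairings with test operators; an averaged operator is placed in a
  submodule via the double orthogonal complement. Submodules are handled through orthogonal
  projectors, which are intertwiners because the representation is unitary. This is what lets
  dephasing preserve every submodule U although it is in general not G-equivariant itself. The
  coefficient comes from comparing two traces over U: the Schur scalar c contributes c * dim U,
  while the projector onto the H-fixed vectors of U, conjugated by any g, contributes the dimension
  of that fixed space. As \<open>coeffH\<close> evaluates the ratio on an arbitrary representative,
  its invariance under isomorphism is needed as well.\<close>

lemma hs_inner_eq_sum: "hs_inner X Y = (\<Sum>i\<in>UNIV. \<Sum>j\<in>UNIV. cnj (X $ i $ j) * Y $ i $ j)"
  unfolding hs_inner_def trace_def adj_def matrix_matrix_mult_def
  by (simp, subst sum.swap, simp)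

lemma hs_inner_add_right: "hs_inner X (Y + Z) = hs_inner X Y + hs_inner X Z"
  and hs_inner_add_left: "hs_inner (Y + Z) X = hs_inner Y X + hs_inner Z X"
  and hs_inner_diff_right: "hs_inner X (Y - Z) = hs_inner X Y - hs_inner X Z"
  by (simp_all add: hs_inner_eq_sum algebra_simps sum.distrib sum_subtractf)

lemma hs_inner_cscale_right: "hs_inner X (cscale c Y) = c * hs_inner X Y"
  and hs_inner_cscale_left: "hs_inner (cscale c X) Y = cnj c * hs_inner X Y"
  by (simp_all add: hs_inner_eq_sum cscale_def sum_distrib_left algebra_simps)

lemma hs_inner_zero_right [simp]: "hs_inner X 0 = 0"
  and hs_inner_zero_left [simp]: "hs_inner 0 X = 0"
  by (simp_all add: hs_inner_eq_sum)

lemma hs_inner_sum_right: "hs_inner X (\<Sum>i\<in>I. f i) = (\<Sum>i\<in>I. hs_inner X (f i))"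
  by (induction I rule: infinite_finite_induct) (simp_all add: hs_inner_add_right)

lemma hs_inner_sum_left: "hs_inner (\<Sum>i\<in>I. f i) X = (\<Sum>i\<in>I. hs_inner (f i) X)"
  by (induction I rule: infinite_finite_induct) (simp_all add: hs_inner_add_left)

lemma cnj_hs_inner: "cnj (hs_inner X Y) = hs_inner Y X"
  by (simp add: hs_inner_eq_sum mult.commute)

lemma hs_inner_eq_0_commute: "hs_inner X Y = 0 \<longleftrightarrow> hs_inner Y X = 0"
  by (metis cnj_hs_inner complex_cnj_zero)

lemma hs_inner_self_sum: "hs_inner X X = complex_of_real (\<Sum>i\<in>UNIV. \<Sum>j\<in>UNIV. (cmod (X $ i $ j))\<^sup>2)"
  by (simp add: hs_inner_eq_sum complex_norm_square mult.commute del: of_real_power)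

lemma hs_inner_self_eq_0_iff [simp]: "hs_inner X X = 0 \<longleftrightarrow> X = 0"
proof
  assume "hs_inner X X = 0"
  then have "(\<Sum>i\<in>UNIV. \<Sum>j\<in>UNIV. (cmod (X $ i $ j))\<^sup>2) = 0"
    by (simp only: hs_inner_self_sum of_real_eq_0_iff)
  then have "X $ i $ j = 0" for i j
    by (simp add: sum_nonneg_eq_0_iff sum_nonneg)
  then show "X = 0" by (simp add: vec_eq_iff)
qed simp

text \<open>Non-degeneracy of the inner product. Identities between values of the channel can
  therefore be verified on scalar pairings.\<close>

lemma hs_inner_eqI: "(\<And>Z. hs_inner Z X = hs_inner Z Y) \<Longrightarrow> X = Y"
  by (metis eq_iff_diff_eq_0 hs_inner_diff_right hs_inner_self_eq_0_iff)

section \<open>Orthonormal systems, matrix units and orthonormal bases of subspaces\<close>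

definition hs_orthonormal :: "(complex^'n^'n) set \<Rightarrow> bool" where
  "hs_orthonormal B \<longleftrightarrow> (\<forall>b\<in>B. \<forall>b'\<in>B. hs_inner b b' = (if b = b' then 1 else 0))"

lemma hs_inner_sum_orthonormal:
  assumes "hs_orthonormal B" "finite B" "b \<in> B"
  shows "hs_inner b (\<Sum>b'\<in>B. cscale (f b') b') = f b"
proof -
  have "hs_inner b (\<Sum>b'\<in>B. cscale (f b') b') = (\<Sum>b'\<in>B. f b' * (if b = b' then 1 else 0))"
    unfolding hs_inner_sum_right hs_inner_cscale_right
    using assms(1,3) by (intro sum.cong) (auto simp: hs_orthonormal_def)
  also have "\<dots> = f b" using assms(2,3) by (simp add: if_distrib cong: if_cong)
  finally show ?thesis .
qed

interpretation cmat: vector_space cscale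
  by unfold_locales (simp_all add: cscale_def vec_eq_iff algebra_simps)

lemma hs_orthonormal_independent:
  assumes "hs_orthonormal B"
  shows "cmat.independent B"
  unfolding cmat.independent_explicit_module
proof (intro allI impI)
  fix t u v assume t: "finite t" "t \<subseteq> B" "(\<Sum>v\<in>t. cscale (u v) v) = 0" "v \<in> t"
  have "hs_orthonormal t" using assms t(2) unfolding hs_orthonormal_def by blast
  from hs_inner_sum_orthonormal[OF this t(1,4), of u] show "u v = 0" using t(3) by simp
qed

text \<open>Indexed by pairs, so that the basis presented to the finite-dimensional locale is a
  single \<open>range\<close>.\<close>

definition matrix_unit :: "'n \<times> 'n \<Rightarrow> complex^'n^'n" where
  "matrix_unit p = (\<chi> i j. if (i, j) = p then 1 else 0)"

lemma hs_inner_matrix_unit: "hs_inner (matrix_unit p) X = X $ fst p $ snd p"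
proof -
  have "hs_inner (matrix_unit p) X = (\<Sum>i\<in>UNIV. \<Sum>j\<in>UNIV. if i = fst p then if j = snd p then X $ i $ j else 0 else 0)"
    unfolding hs_inner_eq_sum matrix_unit_def by (intro sum.cong) (auto simp: prod_eq_iff)
  also have "\<dots> = (\<Sum>i\<in>UNIV. if i = fst p then X $ i $ snd p else 0)"
    by (intro sum.cong) auto
  finally show ?thesis by simp
qed

lemma hs_orthonormal_matrix_units: "hs_orthonormal (range (matrix_unit :: 'n::finite \<times> 'n \<Rightarrow> _))"
proof -
  have 1: "hs_inner (matrix_unit p) (matrix_unit q) = (if p = q then 1 else 0)" for p q :: "'n \<times> 'n"
    unfolding hs_inner_matrix_unit by (simp add: matrix_unit_def)
  then have "matrix_unit p = matrix_unit q \<longleftrightarrow> p = q" for p q :: "'n \<times> 'n"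
    by (metis zero_neq_one)
  with 1 show ?thesis by (auto simp: hs_orthonormal_def)
qed

lemma matrix_units_span: "cmat.span (range matrix_unit) = (UNIV :: (complex^'n^'n) set)"
proof -
  have "X \<in> cmat.span (range matrix_unit)" for X :: "complex^'n^'n"
  proof -
    define Y where "Y = (\<Sum>p\<in>UNIV. cscale (X $ fst p $ snd p) (matrix_unit p))"
    have "X = Y"
    proof (rule hs_inner_eqI)
      fix Z :: "complex^'n^'n"
      have "hs_inner Z (matrix_unit p) = cnj (Z $ fst p $ snd p)" for p
        by (metis cnj_hs_inner hs_inner_matrix_unit)
      then have "hs_inner Z Y = (\<Sum>p\<in>UNIV \<times> UNIV. cnj (Z $ fst p $ snd p) * X $ fst p $ snd p)"
        by (simp add: Y_def hs_inner_sum_right hs_inner_cscale_right mult.commute)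
      also have "\<dots> = hs_inner Z X"
        unfolding hs_inner_eq_sum sum.cartesian_product by (simp add: case_prod_beta)
      finally show "hs_inner Z X = hs_inner Z Y" ..
    qed
    also have "Y \<in> cmat.span (range matrix_unit)"
      unfolding Y_def by (intro cmat.span_sum cmat.span_scale cmat.span_base) auto
    finally show ?thesis .
  qed
  then show ?thesis by auto
qed

interpretation cmat: finite_dimensional_vector_space cscale "range matrix_unit"
  by unfold_locales
    (simp_all add: hs_orthonormal_independent hs_orthonormal_matrix_units matrix_units_span)

lemma hs_orthonormal_finite: "hs_orthonormal B \<Longrightarrow> finite B"
  by (intro cmat.finiteI_independent hs_orthonormal_independent)

text \<open>The basis is an orthonormal subset of S of largest cardinality: if some X in S differed
  from its expansion, the normalised remainder could be added to it.\<close>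

lemma hs_onb_exists:
  assumes S: "cmat.subspace S"
  obtains B where "hs_orthonormal B" "finite B" "B \<subseteq> S" "cmat.span B = S" "card B = cmat.dim S"
    "\<forall>X\<in>S. (\<Sum>b\<in>B. cscale (hs_inner b X) b) = X"
proof -
  have "hs_orthonormal {}" by (simp add: hs_orthonormal_def)
  \<comment> \<open>Independence bounds the cardinality by the dimension; \<open>Suc\<close> gives
    the strict bound that the existence of a maximum asks for.\<close>
  moreover have "card B < Suc (cmat.dim S)" if "hs_orthonormal B \<and> B \<subseteq> S" for B
    using that hs_orthonormal_independent[of B] cmat.independent_card_le_dim[of B S] by (simp add: less_Suc_eq_le)
  ultimately obtain B where B: "hs_orthonormal B" "B \<subseteq> S"
    and max: "\<And>B'. hs_orthonormal B' \<and> B' \<subseteq> S \<Longrightarrow> card B' \<le> card B"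
    using ex_has_greatest_nat[of "\<lambda>B. hs_orthonormal B \<and> B \<subseteq> S" "{}" card "Suc (cmat.dim S)"] by auto
  have fin: "finite B" using B(1) by (rule hs_orthonormal_finite)
  have expand: "(\<Sum>b\<in>B. cscale (hs_inner b X) b) = X" if X: "X \<in> S" for X
  proof (rule ccontr)
    define Y where "Y = X - (\<Sum>b\<in>B. cscale (hs_inner b X) b)"
    assume "(\<Sum>b\<in>B. cscale (hs_inner b X) b) \<noteq> X"
    then have Y0: "Y \<noteq> 0" by (auto simp: Y_def)
    have YS: "Y \<in> S" unfolding Y_def using X B(2) S
      by (intro cmat.subspace_diff cmat.subspace_sum cmat.subspace_scale) auto
    have orth: "hs_inner b Y = 0" if "b \<in> B" for b
      using hs_inner_sum_orthonormal[OF B(1) fin that] by (simp add: Y_def hs_inner_diff_right)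
    \<comment> \<open>\<open>hs_inner\<close> is complex-valued, so positivity is stated for a real
      r, whose square root then normalises Y.\<close>
    obtain r where r: "hs_inner Y Y = complex_of_real r" "r > 0"
    proof
      show "hs_inner Y Y = complex_of_real (\<Sum>i\<in>UNIV. \<Sum>j\<in>UNIV. (cmod (Y $ i $ j))\<^sup>2)"
        by (rule hs_inner_self_sum)
      then have "(\<Sum>i\<in>UNIV. \<Sum>j\<in>UNIV. (cmod (Y $ i $ j))\<^sup>2) \<noteq> 0"
        using Y0 hs_inner_self_eq_0_iff[of Y] by (metis of_real_0)
      moreover have "(\<Sum>i\<in>UNIV. \<Sum>j\<in>UNIV. (cmod (Y $ i $ j))\<^sup>2) \<ge> 0" by (intro sum_nonneg) auto
      ultimately show "(\<Sum>i\<in>UNIV. \<Sum>j\<in>UNIV. (cmod (Y $ i $ j))\<^sup>2) > 0" by linarith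
    qed
    define y where "y = cscale (complex_of_real (1 / sqrt r)) Y"
    have "hs_inner y y = complex_of_real ((1 / sqrt r) * (1 / sqrt r) * r)"
      by (simp only: y_def hs_inner_cscale_left hs_inner_cscale_right r of_real_mult complex_cnj_complex_of_real mult.assoc)
    also have "(1 / sqrt r) * (1 / sqrt r) * r = 1" using r(2) by (simp add: field_simps)
    finally have yy: "hs_inner y y = 1" by simp
    have yorth: "hs_inner b y = 0" "hs_inner y b = 0" if "b \<in> B" for b
      using orth[OF that] hs_inner_eq_0_commute[of b Y]
      by (simp_all add: y_def hs_inner_cscale_left hs_inner_cscale_right)
    have "y \<notin> B" using yorth(1)[of y] yy by auto
    have "hs_orthonormal (insert y B)"
      unfolding hs_orthonormal_def
    proof (intro ballI)
      fix b b' assume "b \<in> insert y B" "b' \<in> insert y B"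
      then show "hs_inner b b' = (if b = b' then 1 else 0)"
        using B(1) yy yorth \<open>y \<notin> B\<close> unfolding hs_orthonormal_def by auto
    qed
    moreover have "y \<in> S" unfolding y_def using YS S by (rule cmat.subspace_scale[rotated])
    ultimately have "card (insert y B) \<le> card B" using B(2) by (intro max) auto
    then show False using \<open>y \<notin> B\<close> fin by simp
  qed
  have "S \<subseteq> cmat.span B"
  proof
    fix X assume "X \<in> S"
    moreover have "(\<Sum>b\<in>B. cscale (hs_inner b X) b) \<in> cmat.span B"
      by (intro cmat.span_sum cmat.span_scale cmat.span_base)
    ultimately show "X \<in> cmat.span B" using expand by simp
  qed
  then have "cmat.span B = S" using B(2) S by (simp add: cmat.span_subspace)
  moreover have "card B = cmat.dim S"
    using B(2) \<open>S \<subseteq> cmat.span B\<close> hs_orthonormal_independent[OF B(1)] by (rule cmat.basis_card_eq_dim)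
  ultimately show thesis using that B fin expand by blast
qed

lemma hs_parseval:
  assumes "(\<Sum>b\<in>B. cscale (hs_inner b X) b) = X"
  shows "(\<Sum>b\<in>B. hs_inner X b * hs_inner b X) = hs_inner X X"
proof -
  have "hs_inner X X = hs_inner X (\<Sum>b\<in>B. cscale (hs_inner b X) b)" using assms by simp
  then show ?thesis by (simp add: hs_inner_sum_right hs_inner_cscale_right mult.commute)
qed

section \<open>Orthogonal projectors and double complements\<close>

lemma hs_proj_eqI:
  assumes S: "cmat.subspace S" and Y: "Y \<in> S" "\<And>Z. Z \<in> S \<Longrightarrow> hs_inner Z (X - Y) = 0"
  shows "hs_proj S X = Y"
  unfolding hs_proj_def
proof (rule the_equality)
  fix Y' assume Y': "Y' \<in> S \<and> (\<forall>Z\<in>S. hs_inner Z (X - Y') = 0)"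
  have "Y - Y' \<in> S" using Y Y' S by (simp add: cmat.subspace_diff)
  then have "hs_inner (Y - Y') (X - Y) = 0" "hs_inner (Y - Y') (X - Y') = 0" using Y Y' by auto
  then have "hs_inner (Y - Y') (Y - Y') = 0" by (simp add: hs_inner_diff_right)
  then show "Y' = Y" by simp
qed (use Y in auto)

text \<open>The expansion of X in an orthonormal basis of S supplies a candidate; since
  \<open>hs_proj\<close> is a definite description, the uniqueness behind \<open>hs_proj_eqI\<close>
  identifies it.\<close>

lemma hs_proj_props:
  assumes S: "cmat.subspace S"
  shows hs_proj_in: "hs_proj S X \<in> S"
    and hs_proj_orth: "Z \<in> S \<Longrightarrow> hs_inner Z (X - hs_proj S X) = 0"
proof -
  obtain B where B: "hs_orthonormal B" "finite B" "B \<subseteq> S" "cmat.span B = S" "card B = cmat.dim S"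
    "\<forall>X\<in>S. (\<Sum>b\<in>B. cscale (hs_inner b X) b) = X"
    by (rule hs_onb_exists[OF S])
  define Y where "Y = (\<Sum>b\<in>B. cscale (hs_inner b X) b)"
  have YS: "Y \<in> S" unfolding Y_def using B(3) S
    by (intro cmat.subspace_sum cmat.subspace_scale) auto
  have orth: "hs_inner Z (X - Y) = 0" if "Z \<in> S" for Z
  proof -
    have "hs_inner b (X - Y) = 0" if "b \<in> B" for b
      using hs_inner_sum_orthonormal[OF B(1,2) that] by (simp add: Y_def hs_inner_diff_right)
    then have "hs_inner (\<Sum>b\<in>B. cscale (hs_inner b Z) b) (X - Y) = 0"
      by (simp add: hs_inner_sum_left hs_inner_cscale_left)
    then show ?thesis using B(6) that by simp
  qed
  have "hs_proj S X = Y" using S YS orth by (rule hs_proj_eqI)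
  then show "hs_proj S X \<in> S" "Z \<in> S \<Longrightarrow> hs_inner Z (X - hs_proj S X) = 0"
    using YS orth by auto
qed

lemma hs_proj_id: "cmat.subspace S \<Longrightarrow> X \<in> S \<Longrightarrow> hs_proj S X = X"
  by (rule hs_proj_eqI) simp_all

lemma hs_proj_eq_0: "cmat.subspace S \<Longrightarrow> (\<And>Z. Z \<in> S \<Longrightarrow> hs_inner Z X = 0) \<Longrightarrow> hs_proj S X = 0"
  by (rule hs_proj_eqI) (simp_all add: cmat.subspace_0)

lemma hs_proj_linear:
  assumes S: "cmat.subspace S"
  shows "Vector_Spaces.linear cscale cscale (hs_proj S)"
proof -
  have "hs_proj S (X + Y) = hs_proj S X + hs_proj S Y" for X Y
  proof (rule hs_proj_eqI[OF S cmat.subspace_add[OF S hs_proj_in[OF S] hs_proj_in[OF S]]])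
    fix Z assume "Z \<in> S"
    have "X + Y - (hs_proj S X + hs_proj S Y) = (X - hs_proj S X) + (Y - hs_proj S Y)" by simp
    then show "hs_inner Z (X + Y - (hs_proj S X + hs_proj S Y)) = 0"
      by (simp only: hs_inner_add_right hs_proj_orth[OF S \<open>Z \<in> S\<close>]) simp
  qed
  moreover have "hs_proj S (cscale c X) = cscale c (hs_proj S X)" for c X
  proof (rule hs_proj_eqI[OF S cmat.subspace_scale[OF S hs_proj_in[OF S]]])
    fix Z assume "Z \<in> S"
    then show "hs_inner Z (cscale c X - cscale c (hs_proj S X)) = 0"
      by (simp only: cmat.scale_right_diff_distrib[symmetric] hs_inner_cscale_right
          hs_proj_orth[OF S \<open>Z \<in> S\<close>]) simp
  qed
  ultimately show ?thesis
    by (simp add: Vector_Spaces.linear_iff cmat.vector_space_axioms)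
qed

text \<open>The remainder X - \<open>hs_proj S X\<close> is orthogonal to S, hence by assumption to
  X, hence to itself.\<close>

lemma hs_double_orthogonal_in_subspace:
  assumes S: "cmat.subspace S" and "\<And>Z. (\<And>Y. Y \<in> S \<Longrightarrow> hs_inner Y Z = 0) \<Longrightarrow> hs_inner Z X = 0"
  shows "X \<in> S"
proof -
  have "hs_inner (X - hs_proj S X) X = 0" using assms(2) hs_proj_orth[OF S] by blast
  moreover have "hs_inner (X - hs_proj S X) (hs_proj S X) = 0"
    using hs_proj_orth[OF S hs_proj_in[OF S]] hs_inner_eq_0_commute by blast
  ultimately have "hs_inner (X - hs_proj S X) (X - hs_proj S X) = 0"
    by (simp add: hs_inner_diff_right)
  then show ?thesis using hs_proj_in[OF S, of X] by simp
qed

section \<open>Eigenvectors of complex endomorphisms\<close>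

text \<open>A root z is split off, p = (x - z) q. Either w = F v - z v vanishes and v is an
  eigenvector, or w lies in U, is annihilated by q(F), and q has smaller degree. The induction runs
  over \<open>N\<close>, which only has to exceed the degree.\<close>

lemma eigenvector_of_annihilating_poly:
  fixes sc :: "complex \<Rightarrow> 'v::ab_group_add \<Rightarrow> 'v"
  assumes lin: "Vector_Spaces.linear sc sc F"
    and inv: "module.subspace sc U" "\<And>x. x \<in> U \<Longrightarrow> F x \<in> U"
    and "v \<in> U" "v \<noteq> 0" "p \<noteq> 0" "degree p < N" "(\<Sum>i<N. sc (coeff p i) ((F ^^ i) v)) = 0"
  shows "\<exists>x\<in>U. \<exists>c. x \<noteq> 0 \<and> F x = sc c x"
  using assms(4-)
proof (induction N arbitrary: p v)
  case (Suc N)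
  interpret F: Vector_Spaces.linear sc sc F by (rule lin)
  have Fi: "Vector_Spaces.linear sc sc (F ^^ i)" for i
  proof (induction i)
    case 0
    show ?case using F.vs1.linear_id by (simp add: id_def)
  next
    case (Suc i)
    then show ?case using Vector_Spaces.linear_compose[OF Suc lin] by (simp add: o_def)
  qed
  show ?case
  proof (cases "degree p = 0")
    case True
    then have zero: "coeff p i = 0" if "i \<noteq> 0" for i using that by (simp add: coeff_eq_0)
    have "(\<Sum>i<Suc N. sc (coeff p i) ((F ^^ i) v)) = sc (coeff p 0) v"
      by (subst sum.lessThan_Suc_shift) (simp add: zero)
    then have "coeff p 0 = 0" using Suc.prems by simp
    then have "p = 0" using zero by (metis coeff_0 poly_eqI)
    then show ?thesis using Suc.prems by simp
  next
    case False
    then obtain z where "poly p z = 0"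
      using fundamental_theorem_of_algebra_alt[of p] by (metis degree_pCons_0)
    then obtain q where q: "p = [:-z, 1:] * q" by (auto simp: poly_eq_0_iff_dvd)
    have "q \<noteq> 0" using q Suc.prems by auto
    then have dq: "degree p = Suc (degree q)" unfolding q by (subst degree_mult_eq) auto
    define w where "w = F v - sc z v"
    have wU: "w \<in> U" unfolding w_def using inv Suc.prems
      by (intro F.vs1.subspace_diff F.vs1.subspace_scale) auto
    show ?thesis
    proof (cases "w = 0")
      case True
      then show ?thesis using Suc.prems unfolding w_def by auto
    next
      case False
      \<comment> \<open>The degree of q is below N, so the sum for z q may be extended by its
        vanishing term at N to the range of the sum for p.\<close>
      have qN: "coeff q N = 0" using dq Suc.prems by (simp add: coeff_eq_0)
      have cp: "coeff p i = (case i of 0 \<Rightarrow> 0 | Suc j \<Rightarrow> coeff q j) - z * coeff q i" for i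
        unfolding q by (simp add: coeff_pCons)
      have "(\<Sum>i<N. sc (coeff q i) ((F ^^ i) w))
          = (\<Sum>i<N. sc (coeff q i) ((F ^^ i) (F v))) - (\<Sum>i<N. sc (z * coeff q i) ((F ^^ i) v))"
        unfolding w_def sum_subtractf[symmetric]
      proof (intro sum.cong refl)
        fix i
        interpret Fi: Vector_Spaces.linear sc sc "F ^^ i" by (rule Fi)
        show "sc (coeff q i) ((F ^^ i) (F v - sc z v))
          = sc (coeff q i) ((F ^^ i) (F v)) - sc (z * coeff q i) ((F ^^ i) v)"
          by (simp add: Fi.diff Fi.scale F.vs1.scale_right_diff_distrib mult.commute)
      qed
      also have "(\<Sum>i<N. sc (z * coeff q i) ((F ^^ i) v)) = (\<Sum>i<Suc N. sc (z * coeff q i) ((F ^^ i) v))"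
        by (simp add: qN)
      also have "(\<Sum>i<N. sc (coeff q i) ((F ^^ i) (F v)))
          = (\<Sum>i<Suc N. sc (case i of 0 \<Rightarrow> 0 | Suc j \<Rightarrow> coeff q j) ((F ^^ i) v))"
        by (subst sum.lessThan_Suc_shift) (simp add: funpow_swap1)
      also have "\<dots> - (\<Sum>i<Suc N. sc (z * coeff q i) ((F ^^ i) v)) = (\<Sum>i<Suc N. sc (coeff p i) ((F ^^ i) v))"
        unfolding sum_subtractf[symmetric] cp by (intro sum.cong refl) (simp add: F.vs1.scale_left_diff_distrib)
      finally have "(\<Sum>i<N. sc (coeff q i) ((F ^^ i) w)) = 0" using Suc.prems by simp
      then show ?thesis using Suc.IH[OF wU False \<open>q \<noteq> 0\<close>] dq Suc.prems by simp
    qed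
  qed
qed simp

text \<open>There is one more vector among v, F v, F^2 v, ... than the dimension allows; the
  coefficients of the resulting relation are packed into a polynomial.\<close>

lemma (in finite_dimensional_vector_space) powers_linearly_dependent:
  fixes F :: "'b \<Rightarrow> 'b"
  shows "\<exists>p N. p \<noteq> 0 \<and> degree p < N \<and> (\<Sum>i<N. scale (coeff p i) ((F ^^ i) v)) = 0"
proof -
  define N where "N = Suc dimension"
  define f where "f i = (F ^^ i) v" for i
  have "\<exists>u. (\<exists>i<N. u i \<noteq> 0) \<and> (\<Sum>i<N. scale (u i) (f i)) = 0"
  proof (cases "inj_on f {..<N}")
    case True
    have "dependent (f ` {..<N})"
    proof (rule ccontr)
      assume "independent (f ` {..<N})"
      then have "card (f ` {..<N}) \<le> dimension"
        using independent_card_le_dim[of "f ` {..<N}" UNIV] by (simp add: dimension_def)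
      then show False using True by (simp add: card_image N_def)
    qed
    then obtain u where u: "\<exists>x\<in>f ` {..<N}. u x \<noteq> 0" "(\<Sum>x\<in>f ` {..<N}. scale (u x) x) = 0"
      by (subst (asm) dependent_finite) auto
    then show ?thesis using True
      by (intro exI[of _ "u \<circ> f"]) (auto simp: sum.reindex)
  next
    case False
    then obtain i j where ij: "i < N" "j < N" "i \<noteq> j" "f i = f j" by (auto simp: inj_on_def)
    \<comment> \<open>Dependence of a set does not see repetitions, so a coincidence f i = f j is
      turned into a relation by the coefficients 1 at i and -1 at j.\<close>
    define u :: "nat \<Rightarrow> 'a" where "u k = (if k = i then 1 else 0) - (if k = j then 1 else 0)" for k
    have "(\<Sum>k<N. scale (u k) (f k)) = (\<Sum>k<N. if k = i then f k else 0) - (\<Sum>k<N. if k = j then f k else 0)"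
      unfolding sum_subtractf[symmetric] u_def by (intro sum.cong) (auto simp: scale_left_diff_distrib)
    also have "\<dots> = 0" using ij by simp
    finally show ?thesis using ij by (intro exI[of _ u]) (auto simp: u_def)
  qed
  then obtain u where u: "\<exists>i<N. u i \<noteq> 0" "(\<Sum>i<N. scale (u i) (f i)) = 0" by auto
  define p where "p = (\<Sum>i<N. monom (u i) i)"
  have cp: "coeff p i = (if i < N then u i else 0)" for i
    by (simp add: p_def coeff_sum if_distrib cong: if_cong)
  have "p \<noteq> 0" using u(1) cp by (metis coeff_0)
  moreover have "degree p < N"
    using cp by (metis \<open>p \<noteq> 0\<close> leading_coeff_neq_0)
  moreover have "(\<Sum>i<N. scale (coeff p i) ((F ^^ i) v)) = 0"
    using u(2) by (simp add: cp f_def)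
  ultimately show ?thesis by blast
qed

lemma cmat_eigenvector_exists:
  fixes F :: "complex^'n^'n \<Rightarrow> complex^'n^'n"
  assumes "Vector_Spaces.linear cscale cscale F" "cmat.subspace U" "\<And>x. x \<in> U \<Longrightarrow> F x \<in> U"
    and "U \<noteq> {0}"
  shows "\<exists>X\<in>U. \<exists>c. X \<noteq> 0 \<and> F X = cscale c X"
proof -
  obtain v where "v \<in> U" "v \<noteq> 0" using assms(2,4) cmat.subspace_0 by blast
  then show ?thesis
    using cmat.powers_linearly_dependent[of F v] eigenvector_of_annihilating_poly[OF assms(1-3)] by blast
qed

section \<open>Operators, kets and bras\<close>

lemma adj_mult: "adj (A ** B) = adj B ** adj A"
  by (simp add: adj_def matrix_matrix_mult_def vec_eq_iff mult.commute)

lemma adj_adj [simp]: "adj (adj A) = A"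
  by (simp add: adj_def vec_eq_iff)

text \<open>Cyclicity of the trace. For the channel it trades the outer conjugation by the adjoint
  of R g for \<open>lact R g\<close> on the test operator.\<close>

lemma hs_inner_conj: "hs_inner (A ** X ** adj A) Y = hs_inner X (adj A ** Y ** A)"
proof -
  have "hs_inner (A ** X ** adj A) Y = trace (A ** (adj X ** (adj A ** Y)))"
    by (simp add: hs_inner_def adj_mult matrix_mul_assoc)
  also have "\<dots> = trace ((adj X ** (adj A ** Y)) ** A)" by (rule trace_mul_sym)
  finally show ?thesis by (simp add: hs_inner_def matrix_mul_assoc)
qed

lemma hs_inner_lact_unitary:
  assumes "unitary (R g)"
  shows "hs_inner (lact R g X) (lact R g Y) = hs_inner X Y"
proof -
  have "adj (R g) ** (R g ** Y ** adj (R g)) ** R g = (adj (R g) ** R g) ** Y ** (adj (R g) ** R g)"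
    by (simp add: matrix_mul_assoc)
  then show ?thesis
    using assms by (simp add: lact_def hs_inner_conj unitary_def)
qed

lemma mult_cscale_left: "cscale c A ** B = cscale c (A ** B)"
  and mult_cscale_right: "A ** cscale c B = cscale c (A ** B)"
  by (simp_all add: cscale_def matrix_matrix_mult_def vec_eq_iff sum_distrib_left algebra_simps)

lemma mult_add_left: "(A + B) ** C = A ** C + B ** (C :: complex^'n^'n)"
  by (simp add: matrix_matrix_mult_def vec_eq_iff sum.distrib algebra_simps)

lemma lact_linear: "Vector_Spaces.linear cscale cscale (lact R g)"
  by (simp add: Vector_Spaces.linear_iff cmat.vector_space_axioms lact_def mult_cscale_left
      mult_cscale_right matrix_add_ldistrib mult_add_left)

interpretation lact: Vector_Spaces.linear cscale cscale "lact R g" for R g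
  by (rule lact_linear)

section \<open>Kets, bras and orthonormal bases of the underlying space\<close>

lemma cinner_add_right: "cinner u (v + w) = cinner u v + cinner u w"
  and cinner_smult_right: "cinner u (c *s v) = c * cinner u v"
  and cinner_smult_left: "cinner (c *s u) v = cnj c * cinner u v"
  and cinner_zero_right: "cinner u 0 = 0"
  by (simp_all add: cinner_def sum.distrib sum_distrib_left algebra_simps)

lemma cinner_sum_right: "cinner u (\<Sum>i\<in>I. f i) = (\<Sum>i\<in>I. cinner u (f i))"
  by (induction I rule: infinite_finite_induct) (simp_all add: cinner_add_right cinner_zero_right)

lemma cinner_axis: "cinner (axis i 1) v = v $ i"
proof -
  have "cinner (axis i 1) v = (\<Sum>k\<in>UNIV. if k = i then v $ k else 0)"
    unfolding cinner_def axis_def by (intro sum.cong) auto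
  then show ?thesis by simp
qed

lemma cinner_unitary:
  assumes "unitary U"
  shows "cinner (U *v u) (U *v v) = cinner u v"
proof -
  have "cinner (U *v u) (U *v v) = (\<Sum>i\<in>UNIV. \<Sum>j\<in>UNIV. cnj (U $ i $ j) * cnj (u $ j) * (U *v v) $ i)"
    by (simp add: cinner_def matrix_vector_mult_def sum_distrib_right)
  also have "\<dots> = (\<Sum>j\<in>UNIV. \<Sum>i\<in>UNIV. cnj (U $ i $ j) * cnj (u $ j) * (U *v v) $ i)"
    by (rule sum.swap)
  also have "\<dots> = cinner u (adj U *v (U *v v))"
    unfolding cinner_def matrix_vector_mult_def[of "adj U"]
    by (simp add: adj_def sum_distrib_left mult_ac)
  also have "\<dots> = cinner u v"
    using assms by (simp add: matrix_vector_mul_assoc unitary_def)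
  finally show ?thesis .
qed

lemma hs_inner_ket_bra: "hs_inner (ket_bra u v) X = cinner u (X *v v)"
  by (simp add: hs_inner_eq_sum ket_bra_def cinner_def matrix_vector_mult_def sum_distrib_left mult_ac)

lemma ket_bra_mult_vec: "ket_bra u v *v x = cinner v x *s u"
  by (simp add: ket_bra_def cinner_def matrix_vector_mult_def vec_eq_iff sum_distrib_left sum_distrib_right mult_ac)

lemma hs_inner_ket_bra_ket_bra: "hs_inner (ket_bra u v) (ket_bra u' v') = cinner u u' * cinner v' v"
  by (simp add: hs_inner_ket_bra ket_bra_mult_vec cinner_smult_right)

lemma ket_bra_add_left: "ket_bra (u + v) w = ket_bra u w + ket_bra v w"
  and ket_bra_add_right: "ket_bra w (u + v) = ket_bra w u + ket_bra w v"
  and ket_bra_smult_left: "ket_bra (c *s u) w = cscale c (ket_bra u w)"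
  and ket_bra_smult_right: "ket_bra w (c *s u) = cscale (cnj c) (ket_bra w u)"
  and ket_bra_zero_left: "ket_bra 0 w = 0"
  and ket_bra_zero_right: "ket_bra w 0 = 0"
  by (simp_all add: ket_bra_def cscale_def vec_eq_iff algebra_simps)

lemma lact_ket_bra: "lact R g (ket_bra u v) = ket_bra (R g *v u) (R g *v v)"
proof -
  have "lact R g (ket_bra u v) $ i $ j = ket_bra (R g *v u) (R g *v v) $ i $ j" for i j
  proof -
    have "lact R g (ket_bra u v) $ i $ j
        = (\<Sum>l\<in>UNIV. (\<Sum>k\<in>UNIV. R g $ i $ k * u $ k) * (cnj (v $ l) * cnj (R g $ j $ l)))"
      by (simp add: lact_def ket_bra_def adj_def matrix_matrix_mult_def sum_distrib_left sum_distrib_right mult_ac)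
    also have "\<dots> = ket_bra (R g *v u) (R g *v v) $ i $ j"
      by (simp add: ket_bra_def matrix_vector_mult_def sum_distrib_left mult_ac)
    finally show ?thesis .
  qed
  then show ?thesis by (simp add: vec_eq_iff)
qed

lemma orthonormal_independent:
  assumes "\<forall>w\<in>W. \<forall>w'\<in>W. cinner w w' = (if w = w' then 1 else 0)"
  shows "vec.independent W"
  unfolding vec.independent_explicit_module
proof (intro allI impI)
  fix t u v assume t: "finite t" "t \<subseteq> W" "(\<Sum>v\<in>t. u v *s v) = 0" "v \<in> t"
  have "cinner v (\<Sum>w\<in>t. u w *s w) = (\<Sum>w\<in>t. u w * (if v = w then 1 else 0))"
    unfolding cinner_sum_right cinner_smult_right
  proof (intro sum.cong refl)
    fix w assume "w \<in> t"
    then have "cinner v w = (if v = w then 1 else 0)" using assms t(2,4) by blast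
    then show "u w * cinner v w = u w * (if v = w then 1 else 0)" by simp
  qed
  also have "\<dots> = u v" using t by (simp add: if_distrib cong: if_cong)
  finally show "u v = 0" using t by (simp add: cinner_zero_right)
qed

lemma onb_finite: "onb W \<Longrightarrow> finite W"
  unfolding onb_def by (intro vec.finiteI_independent orthonormal_independent) blast

text \<open>Additivity and homogeneity in each slot extend the hypothesis from W to all vectors; the
  standard axes then read off the entries of D v.\<close>

lemma onb_hs_inner_ket_bra_eq_0:
  assumes W: "onb W" and 0: "\<And>w w'. w \<in> W \<Longrightarrow> w' \<in> W \<Longrightarrow> hs_inner (ket_bra w w') D = 0"
  shows "D = 0"
proof -
  have 1: "hs_inner (ket_bra w v) D = 0" if "w \<in> W" for w v
  proof -
    have "v \<in> vec.span W" using W by (simp add: onb_def)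
    then show ?thesis
      by (induction rule: vec.span_induct_alt)
        (simp_all add: ket_bra_zero_right ket_bra_add_right ket_bra_smult_right hs_inner_add_left
          hs_inner_cscale_left 0 that)
  qed
  have 2: "hs_inner (ket_bra u v) D = 0" for u v
  proof -
    have "u \<in> vec.span W" using W by (simp add: onb_def)
    then show ?thesis
      by (induction rule: vec.span_induct_alt)
        (simp_all add: ket_bra_zero_left ket_bra_add_left ket_bra_smult_left hs_inner_add_left
          hs_inner_cscale_left 1)
  qed
  have "D *v v = 0" for v
    using 2[of _ v] unfolding hs_inner_ket_bra by (metis cinner_axis vec_eq_iff zero_index)
  then show ?thesis by (metis matrix_eq matrix_vector_mult_0)
qed

lemma dephase_eq: "dephase W X = (\<Sum>w\<in>W. cscale (hs_inner (ket_bra w w) X) (ket_bra w w))"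
  by (simp add: dephase_def hs_inner_ket_bra)

lemma hs_inner_dephase: "hs_inner Z (dephase W X) = hs_inner (dephase W Z) X"
  by (simp add: dephase_eq hs_inner_sum_left hs_inner_sum_right hs_inner_cscale_left
      hs_inner_cscale_right cnj_hs_inner mult.commute)

lemma hs_inner_ket_bra_dephase:
  assumes "onb W" "w \<in> W" "w' \<in> W"
  shows "hs_inner (ket_bra w w') (dephase W X) = (if w = w' then hs_inner (ket_bra w w) X else 0)"
proof -
  have "hs_inner (ket_bra w w') (dephase W X)
      = (\<Sum>v\<in>W. if v = w then if w = w' then hs_inner (ket_bra v v) X else 0 else 0)"
    unfolding dephase_eq hs_inner_sum_right hs_inner_cscale_right hs_inner_ket_bra_ket_bra
    using assms by (intro sum.cong) (auto simp: onb_def)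
  then show ?thesis using assms onb_finite[OF assms(1)] by simp
qed

lemma dephase_eq_self:
  assumes W: "onb W"
    and 0: "\<And>w w'. w \<in> W \<Longrightarrow> w' \<in> W \<Longrightarrow> w \<noteq> w' \<Longrightarrow> hs_inner (ket_bra w w') X = 0"
  shows "dephase W X = X"
proof -
  have "X - dephase W X = 0"
    using W 0 by (intro onb_hs_inner_ket_bra_eq_0[OF W])
      (auto simp: hs_inner_diff_right hs_inner_ket_bra_dephase)
  then show ?thesis by simp
qed

section \<open>Block-diagonal operators and dephasing\<close>

lemma LD_subspace: "cmat.subspace (LD Ws)"
  by (simp add: LD_def)

text \<open>\<open>LD Ws\<close> is generated by kets and bras from the basis only. The extension to
  the span of a block is needed because R g moves basis vectors inside that span, not inside the
  block.\<close>

lemma ket_bra_in_LD: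
  assumes B: "B \<in> Ws" and "u \<in> vec.span B" "v \<in> vec.span B"
  shows "ket_bra u v \<in> LD Ws"
proof -
  have 1: "ket_bra w v \<in> LD Ws" if "w \<in> B" for w
    using \<open>v \<in> vec.span B\<close>
  proof (induction rule: vec.span_induct_alt)
    case base
    then show ?case by (simp add: ket_bra_zero_right cmat.subspace_0[OF LD_subspace])
  next
    case (step c x y)
    have "ket_bra w x \<in> LD Ws" unfolding LD_def using B that step by (intro cmat.span_base) blast
    then show ?case using step
      by (simp add: ket_bra_add_right ket_bra_smult_right cmat.subspace_add[OF LD_subspace]
          cmat.subspace_scale[OF LD_subspace])
  qed
  show ?thesis using \<open>u \<in> vec.span B\<close>
    by (induction rule: vec.span_induct_alt)
      (simp_all add: 1 ket_bra_zero_left ket_bra_add_left ket_bra_smult_left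
        cmat.subspace_0[OF LD_subspace] cmat.subspace_add[OF LD_subspace] cmat.subspace_scale[OF LD_subspace])
qed

lemma fourier_basisD:
  assumes "fourier_basis G R W Ws"
  shows fourier_basis_onb: "onb W"
    and fourier_basis_subset: "B \<in> Ws \<Longrightarrow> w \<in> B \<Longrightarrow> w \<in> W"
    and fourier_basis_disjoint: "B \<in> Ws \<Longrightarrow> B' \<in> Ws \<Longrightarrow> w \<in> B \<Longrightarrow> w \<in> B' \<Longrightarrow> B = B'"
    and fourier_basis_invariant:
      "B \<in> Ws \<Longrightarrow> g \<in> carrier G \<Longrightarrow> v \<in> vec.span B \<Longrightarrow> R g *v v \<in> vec.span B"
  using assms unfolding fourier_basis_def irred_sub_def invariant_sub_def hact_def by auto

lemma LD_invariant:
  assumes fb: "fourier_basis G R W Ws" and g: "g \<in> carrier G" and X: "X \<in> LD Ws"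
  shows "lact R g X \<in> LD Ws"
  using X unfolding LD_def
proof (induction rule: cmat.span_induct_alt)
  case base
  show ?case by (simp add: cmat.span_zero)
next
  case (step c x y)
  then obtain w w' B where B: "B \<in> Ws" "w \<in> B" "w' \<in> B" "x = ket_bra w w'" by blast
  have "R g *v u \<in> vec.span B" if "u \<in> B" for u
    by (intro fourier_basis_invariant[OF fb B(1) g] vec.span_base that)
  then have "lact R g x \<in> LD Ws"
    unfolding B(4) lact_ket_bra using B by (intro ket_bra_in_LD[OF B(1)]) auto
  then show ?case using step(2)
    by (simp add: LD_def lact.add lact.scale cmat.span_add cmat.span_scale)
qed

lemma LD_off_block:
  assumes fb: "fourier_basis G R W Ws" and X: "X \<in> LD Ws"
    and B: "B \<in> Ws" "B' \<in> Ws" "B \<noteq> B'" "w \<in> B" "w' \<in> B'"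
  shows "hs_inner (ket_bra w w') X = 0"
  using X unfolding LD_def
proof (induction rule: cmat.span_induct_alt)
  case (step c x y)
  then obtain u u' B'' where u: "B'' \<in> Ws" "u \<in> B''" "u' \<in> B''" "x = ket_bra u u'" by blast
  have "u \<noteq> w \<or> u' \<noteq> w'"
    using fourier_basis_disjoint[OF fb B(1) u(1) B(4)] fourier_basis_disjoint[OF fb B(2) u(1) B(5)]
      u(2,3) B(3) by metis
  moreover have "u \<in> W" "u' \<in> W" "w \<in> W" "w' \<in> W"
    using fourier_basis_subset[OF fb] B u by blast+
  then have "cinner w u = (if w = u then 1 else 0)" "cinner u' w' = (if u' = w' then 1 else 0)"
    using fourier_basis_onb[OF fb] by (simp_all add: onb_def)
  ultimately have "hs_inner (ket_bra w w') x = 0"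
    unfolding u(4) hs_inner_ket_bra_ket_bra by auto
  then show ?case using step by (simp add: hs_inner_add_right hs_inner_cscale_right)
qed simp

text \<open>For irreducible U of type lambda, the dimension of this space is the numerator d^H of
  the coefficient in \<open>coeffH\<close>.\<close>

definition fixed_by :: "('g \<Rightarrow> complex^'n^'n) \<Rightarrow> 'g set \<Rightarrow> (complex^'n^'n) set \<Rightarrow> (complex^'n^'n) set" where
  "fixed_by R H U = {X \<in> U. \<forall>h\<in>H. lact R h X = X}"

lemma fixed_by_subspace: "cmat.subspace U \<Longrightarrow> cmat.subspace (fixed_by R H U)"
  by (auto simp: fixed_by_def cmat.subspace_def lact.add lact.scale)

text \<open>Otherwise w and w' would be two orthonormal vectors in the joint eigenspace of one
  character, whose dimension within a block is at most 1.\<close>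

lemma ndcse_separates:
  assumes nd: "NDCSE G R H W Ws" and B: "B \<in> Ws" and w: "w \<in> B" "w' \<in> B" "w \<noteq> w'"
  shows "\<exists>h\<in>H. \<exists>c c'. c \<noteq> c' \<and> R h *v w = c *s w \<and> R h *v w' = c' *s w'"
proof -
  have fb: "fourier_basis G R W Ws" using nd by (simp add: NDCSE_def CSE_def)
  have inW: "w \<in> W" "w' \<in> W" using fb B w by (auto simp: fourier_basis_def)
  have eig: "\<forall>h\<in>H. \<exists>c. R h *v w = c *s w" "\<forall>h\<in>H. \<exists>c. R h *v w' = c *s w'"
    using nd inW by (auto simp: NDCSE_def CSE_def)
  then obtain chr where chr: "\<forall>h\<in>H. R h *v w = chr h *s w" by metis
  define V where "V = {v \<in> vec.span B. \<forall>h\<in>H. R h *v v = chr h *s v}"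
  have "\<not> (\<forall>h\<in>H. R h *v w' = chr h *s w')"
  proof
    assume "\<forall>h\<in>H. R h *v w' = chr h *s w'"
    then have "{w, w'} \<subseteq> V" using chr w by (auto simp: V_def vec.span_base)
    moreover have "vec.independent {w, w'}"
      using fb inW by (intro orthonormal_independent) (auto simp: fourier_basis_def onb_def)
    ultimately have "card {w, w'} \<le> vec.dim V" by (rule vec.independent_card_le_dim)
    moreover have "vec.dim V \<le> 1" using nd B unfolding NDCSE_def V_def by blast
    ultimately show False using w by simp
  qed
  then show ?thesis using chr eig by metis
qed

lemma unitary_eigenvalue:
  assumes "unitary U" "U *v w = c *s w" "cinner w w = 1"
  shows "cnj c * c = 1"
  using cinner_unitary[OF assms(1), of w w] assms(2,3)
  by (simp add: cinner_smult_left cinner_smult_right mult.commute)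

text \<open>Dephasing is self-adjoint, maps into the fixed space and is the identity there, which
  characterises the orthogonal projector. It is the identity because fixed operators are diagonal in
  W: entries between different blocks vanish in \<open>LD Ws\<close>, and inside a block H
  multiplies off-diagonal entries by nontrivial phases.\<close>

lemma dephase_eq_hs_proj:
  assumes nd: "NDCSE G R H W Ws" and un: "\<And>h. h \<in> H \<Longrightarrow> unitary (R h)"
  shows "dephase W X = hs_proj (fixed_by R H (LD Ws)) X"
proof -
  have fb: "fourier_basis G R W Ws" using nd by (simp add: NDCSE_def CSE_def)
  then have W: "onb W" by (simp add: fourier_basis_def)
  have sub: "cmat.subspace (fixed_by R H (LD Ws))" by (intro fixed_by_subspace LD_subspace)
  have in_fix: "dephase W Y \<in> fixed_by R H (LD Ws)" for Y
    unfolding dephase_eq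
  proof (intro cmat.subspace_sum[OF sub] cmat.subspace_scale[OF sub])
    fix w assume w: "w \<in> W"
    then have "ket_bra w w \<in> LD Ws"
      using fb ket_bra_in_LD[OF _ vec.span_base vec.span_base] by (fastforce simp: fourier_basis_def)
    moreover have "lact R h (ket_bra w w) = ket_bra w w" if h: "h \<in> H" for h
    proof -
      obtain c where c: "R h *v w = c *s w" using nd w h unfolding NDCSE_def CSE_def by blast
      have "cnj c * c = 1" using un[OF h] c W w by (intro unitary_eigenvalue) (auto simp: onb_def)
      then show ?thesis by (simp add: lact_ket_bra c ket_bra_smult_left ket_bra_smult_right mult.commute)
    qed
    ultimately show "ket_bra w w \<in> fixed_by R H (LD Ws)" by (simp add: fixed_by_def)
  qed
  have fixd: "dephase W Y = Y" if Y: "Y \<in> fixed_by R H (LD Ws)" for Y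
  proof (rule dephase_eq_self[OF W])
    fix w w' assume w: "w \<in> W" "w' \<in> W" "w \<noteq> w'"
    obtain B B' where B: "B \<in> Ws" "B' \<in> Ws" "w \<in> B" "w' \<in> B'"
      using fb w by (auto simp: fourier_basis_def)
    show "hs_inner (ket_bra w w') Y = 0"
    proof (cases "B = B'")
      case False
      then show ?thesis using Y B by (intro LD_off_block[OF fb]) (auto simp: fixed_by_def)
    next
      case True
      then obtain h c c' where h: "h \<in> H" "c \<noteq> c'" "R h *v w = c *s w" "R h *v w' = c' *s w'"
        using ndcse_separates[OF nd B(1) B(3)] B w by blast
      have c1: "cnj c * c = 1" using un[OF h(1)] h W w by (intro unitary_eigenvalue) (auto simp: onb_def)
      \<comment> \<open>Invariance under h multiplies the matrix element by cnj c * c'. This factor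
        is 1 only if c' = c, because cnj c is the inverse of c.\<close>
      have "hs_inner (ket_bra w w') Y = hs_inner (lact R h (ket_bra w w')) (lact R h Y)"
        using hs_inner_lact_unitary[of R h] un[OF h(1)] by simp
      also have "lact R h Y = Y" using Y h by (simp add: fixed_by_def)
      also have "hs_inner (lact R h (ket_bra w w')) Y = cnj c * c' * hs_inner (ket_bra w w') Y"
        by (simp add: lact_ket_bra h ket_bra_smult_left ket_bra_smult_right hs_inner_cscale_left)
      finally have "(1 - cnj c * c') * hs_inner (ket_bra w w') Y = 0" by (simp add: algebra_simps)
      moreover have "cnj c * c' \<noteq> 1"
        using c1 h(2) by (metis mult_cancel_left mult_zero_left zero_neq_one)
      ultimately show ?thesis by simp
    qed
  qed
  show ?thesis
  proof (rule hs_proj_eqI[OF sub in_fix, symmetric])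
    fix Z assume "Z \<in> fixed_by R H (LD Ws)"
    then show "hs_inner Z (X - dephase W X) = 0"
      by (simp add: hs_inner_diff_right hs_inner_dephase fixd)
  qed
qed

section \<open>Integration against Haar measure\<close>

lemma borel_of_measurable:
  assumes "continuous_map T euclidean f" "space \<mu> = topspace T" "sets \<mu> = sets (borel_of T)"
  shows "f \<in> borel_measurable \<mu>"
proof (rule borel_measurableI)
  fix S :: "'b set" assume "open S"
  then have "openin T {x \<in> topspace T. f x \<in> S}"
    using assms(1) by (simp add: continuous_map_def)
  moreover have "f -` S \<inter> space \<mu> = {x \<in> topspace T. f x \<in> S}" using assms(2) by auto
  moreover have "sets (borel_of T) = sigma_sets (topspace T) {U. openin T U}"
    unfolding borel_of_def by (intro sets_measure_of) (auto dest: openin_subset)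
  ultimately show "f -` S \<inter> space \<mu> \<in> sets \<mu>" using assms(3) by auto
qed

text \<open>The image of a compact space is compact, hence bounded, and constants are integrable for
  a probability measure.\<close>

lemma haar_integrable:
  fixes f :: "'g \<Rightarrow> 'e::euclidean_space"
  assumes "compact_group G T" "haar_prob G T \<mu>" and f: "continuous_map T euclidean f"
  shows "integrable \<mu> f"
proof -
  interpret prob_space \<mu> using assms by (simp add: haar_prob_def)
  have sp: "space \<mu> = topspace T" and "sets \<mu> = sets (borel_of T)"
    using assms by (simp_all add: haar_prob_def compact_group_def)
  then have meas: "f \<in> borel_measurable \<mu>" using f by (intro borel_of_measurable)
  have "compactin T (topspace T)"
    using assms(1) unfolding compact_group_def compact_space_def by blast
  then have "compact (f ` topspace T)" using f image_compactin by fastforce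
  then obtain b where "\<forall>x\<in>topspace T. norm (f x) \<le> b"
    by (metis compact_imp_bounded bounded_iff image_eqI)
  then show ?thesis using meas sp by (intro integrable_const_bound[where B = b]) auto
qed

lemma haar_integral_right_translate:
  fixes f :: "'g \<Rightarrow> 'e::euclidean_space"
  assumes cg: "compact_group G T" and hp: "haar_prob G T \<mu>"
    and f: "continuous_map T euclidean f" and k: "k \<in> carrier G"
  shows "(\<integral>g. f (g \<otimes>\<^bsub>G\<^esub> k) \<partial>\<mu>) = (\<integral>g. f g \<partial>\<mu>)"
proof -
  interpret group G using cg by (simp add: compact_group_def)
  have sp: "space \<mu> = carrier G" "topspace T = carrier G" "sets \<mu> = sets (borel_of T)"
    using cg hp by (simp_all add: haar_prob_def compact_group_def)
  have "continuous_map T (prod_topology T T) (\<lambda>g. (g, k))"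
    using k sp by (simp add: continuous_map_pairwise o_def)
  then have cont: "continuous_map T T (\<lambda>g. g \<otimes>\<^bsub>G\<^esub> k)"
    using cg continuous_map_compose[of T "prod_topology T T" "\<lambda>g. (g, k)" T "\<lambda>(x, y). x \<otimes>\<^bsub>G\<^esub> y"]
    by (simp add: compact_group_def o_def)
  have sets: "sets \<mu> = sigma_sets (carrier G) {U. openin T U}"
  proof -
    have "{U. openin T U} \<subseteq> Pow (carrier G)" using sp(2) openin_subset by fastforce
    then show ?thesis unfolding sp(3) borel_of_def sp(2) by (rule sets_measure_of)
  qed
  have meas: "(\<lambda>g. g \<otimes>\<^bsub>G\<^esub> k) \<in> measurable \<mu> \<mu>"
  proof (rule measurable_sigma_sets[OF sets])
    show "{U. openin T U} \<subseteq> Pow (carrier G)" using sp(2) openin_subset by fastforce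
    show "(\<lambda>g. g \<otimes>\<^bsub>G\<^esub> k) \<in> space \<mu> \<rightarrow> carrier G" using k sp by auto
    fix U assume "U \<in> {U. openin T U}"
    then have "openin T {g \<in> topspace T. g \<otimes>\<^bsub>G\<^esub> k \<in> U}"
      using cont by (simp add: continuous_map_def)
    moreover have "(\<lambda>g. g \<otimes>\<^bsub>G\<^esub> k) -` U \<inter> space \<mu> = {g \<in> topspace T. g \<otimes>\<^bsub>G\<^esub> k \<in> U}"
      using sp by auto
    ultimately show "(\<lambda>g. g \<otimes>\<^bsub>G\<^esub> k) -` U \<inter> space \<mu> \<in> sets \<mu>" by (auto simp: sets)
  qed
  have "distr \<mu> \<mu> (\<lambda>g. g \<otimes>\<^bsub>G\<^esub> k) = \<mu>"
  proof (rule measure_eqI)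
    fix A assume "A \<in> sets (distr \<mu> \<mu> (\<lambda>g. g \<otimes>\<^bsub>G\<^esub> k))"
    then have A: "A \<in> sets \<mu>" by simp
    then have "A \<subseteq> carrier G" using sets.sets_into_space sp by blast
    \<comment> \<open>Haar invariance is formulated with images of sets, so the preimage under
      translation by k is rewritten as the image under translation by its inverse.\<close>
    have "(\<lambda>g. g \<otimes>\<^bsub>G\<^esub> k) -` A \<inter> space \<mu> = (\<lambda>x. x \<otimes>\<^bsub>G\<^esub> inv\<^bsub>G\<^esub> k) ` A"
    proof (intro equalityI subsetI)
      fix g assume g: "g \<in> (\<lambda>g. g \<otimes>\<^bsub>G\<^esub> k) -` A \<inter> space \<mu>"
      then have "g = (g \<otimes>\<^bsub>G\<^esub> k) \<otimes>\<^bsub>G\<^esub> inv\<^bsub>G\<^esub> k" using k sp by (simp add: m_assoc)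
      then show "g \<in> (\<lambda>x. x \<otimes>\<^bsub>G\<^esub> inv\<^bsub>G\<^esub> k) ` A" using g by blast
    next
      fix g assume "g \<in> (\<lambda>x. x \<otimes>\<^bsub>G\<^esub> inv\<^bsub>G\<^esub> k) ` A"
      then show "g \<in> (\<lambda>g. g \<otimes>\<^bsub>G\<^esub> k) -` A \<inter> space \<mu>"
        using \<open>A \<subseteq> carrier G\<close> k sp by (auto simp: m_assoc subset_iff)
    qed
    then show "emeasure (distr \<mu> \<mu> (\<lambda>g. g \<otimes>\<^bsub>G\<^esub> k)) A = emeasure \<mu> A"
      using hp A k meas by (simp add: emeasure_distr haar_prob_def)
  qed simp
  then have "(\<integral>g. f g \<partial>\<mu>) = (\<integral>g. f g \<partial>(distr \<mu> \<mu> (\<lambda>g. g \<otimes>\<^bsub>G\<^esub> k)))" by simp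
  also have "\<dots> = (\<integral>g. f (g \<otimes>\<^bsub>G\<^esub> k) \<partial>\<mu>)"
    using meas f sp by (intro integral_distr borel_of_measurable) auto
  finally show ?thesis by simp
qed

lemma hs_inner_bounded_linear: "bounded_linear (hs_inner (Z :: complex^'n^'n))"
proof -
  have "linear (hs_inner Z)"
  proof (rule linearI)
    fix r :: real and X :: "complex^'n^'n"
    have "r *\<^sub>R X = cscale (complex_of_real r) X"
      by (simp add: vec_eq_iff cscale_def scaleR_conv_of_real[where 'a = complex])
    then show "hs_inner Z (r *\<^sub>R X) = r *\<^sub>R hs_inner Z X"
      by (simp add: hs_inner_cscale_right scaleR_conv_of_real)
  qed (rule hs_inner_add_right)
  then show ?thesis by (simp add: linear_conv_bounded_linear)
qed

section \<open>Continuity of the integrand and the weak form of the channel\<close>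

lemma continuous_on_matrix_mult [continuous_intros]:
  fixes f g :: "'a::topological_space \<Rightarrow> complex^'n^'n"
  assumes "continuous_on S f" "continuous_on S g"
  shows "continuous_on S (\<lambda>x. f x ** g x)"
  unfolding matrix_matrix_mult_def by (intro continuous_intros assms)

lemma continuous_on_adj [continuous_intros]:
  "continuous_on S f \<Longrightarrow> continuous_on S (\<lambda>x. adj (f x))"
  unfolding adj_def by (intro continuous_intros)

lemma continuous_on_cscale [continuous_intros]:
  "continuous_on S f \<Longrightarrow> continuous_on S (\<lambda>x. cscale (f x) A)"
  unfolding cscale_def by (intro continuous_intros)

lemma continuous_on_hs_inner [continuous_intros]:
  "continuous_on S f \<Longrightarrow> continuous_on S g \<Longrightarrow> continuous_on S (\<lambda>x. hs_inner (f x) (g x))"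
  unfolding hs_inner_eq_sum by (intro continuous_intros)

lemma continuous_on_dephase [continuous_intros]:
  "continuous_on S f \<Longrightarrow> continuous_on S (\<lambda>x. dephase W (f x))"
  unfolding dephase_eq by (intro continuous_intros)

text \<open>\<open>T\<close> is an explicit topology on the group, whereas matrix expressions are
  continuous in the sense of their type. Viewing the integrand as a fixed expression in R g
  separates the two.\<close>

lemma continuous_map_comp_continuous:
  "continuous_map T euclidean R \<Longrightarrow> continuous_on UNIV \<phi> \<Longrightarrow> continuous_map T euclidean (\<lambda>g. \<phi> (R g))"
  using continuous_map_compose[of T euclidean R euclidean \<phi>] by (simp add: o_def)

lemma continuous_map_lact_dephase:
  assumes "continuous_map T euclidean R"
  shows "continuous_map T euclidean (\<lambda>g. hs_inner (lact R g Z) (dephase W (lact R g X)))"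
  unfolding lact_def
  by (rule continuous_map_comp_continuous[OF assms, of "\<lambda>A. hs_inner (A ** Z ** adj A) (dephase W (A ** X ** adj A))"])
     (intro continuous_intros)

text \<open>The integral commutes with the bounded linear functional \<open>hs_inner Z\<close>. In
  this form g acts on both arguments, and later arguments need only scalar integrals.\<close>

lemma hs_inner_meas_channel:
  assumes "compact_group G T" "haar_prob G T \<mu>" "cont_unitary_rep G T R"
  shows "hs_inner Z (meas_channel \<mu> R W X) = (\<integral>g. hs_inner (lact R g Z) (dephase W (lact R g X)) \<partial>\<mu>)"
proof -
  have R: "continuous_map T euclidean R" using assms(3) by (simp add: cont_unitary_rep_def)
  have "continuous_map T euclidean (\<lambda>g. adj (R g) ** dephase W (R g ** X ** adj (R g)) ** R g)"
    by (rule continuous_map_comp_continuous[OF R, of "\<lambda>A. adj A ** dephase W (A ** X ** adj A) ** A"])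
       (intro continuous_intros)
  then have "integrable \<mu> (\<lambda>g. adj (R g) ** dephase W (R g ** X ** adj (R g)) ** R g)"
    using assms by (intro haar_integrable)
  then show ?thesis
    unfolding meas_channel_def
    by (subst integral_bounded_linear[OF hs_inner_bounded_linear, symmetric])
      (simp_all add: lact_def hs_inner_conj)
qed

interpretation cmat: finite_dimensional_vector_space_pair
  cscale "range matrix_unit" cscale "range matrix_unit" ..

section \<open>The operator representation\<close>

locale ndcse_rep =
  fixes G :: "('g, 'b) monoid_scheme" and T :: "'g topology" and \<mu> :: "'g measure"
    and R :: "'g \<Rightarrow> complex^'n^'n" and H :: "'g set"
    and W :: "(complex^'n) set" and Ws :: "(complex^'n) set set"
  assumes cg: "compact_group G T"
    and hp: "haar_prob G T \<mu>"
    and rep: "cont_unitary_rep G T R"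
    and sub: "subgroup H G"
    and nd: "NDCSE G R H W Ws"
begin

sublocale G: group G using cg by (simp add: compact_group_def)
sublocale prob_space \<mu> using hp by (simp add: haar_prob_def)

abbreviation "M \<equiv> meas_channel \<mu> R W"
abbreviation "inv_LD \<equiv> invariant_sub cscale (carrier G) (lact R) (LD Ws)"
abbreviation "irr_LD \<equiv> irred_sub cscale (carrier G) (lact R) (LD Ws)"
abbreviation "g_iso \<equiv> iso_sub cscale (carrier G) (lact R)"
abbreviation "Iso \<equiv> isotypics cscale (carrier G) (lact R) (LD Ws)"
abbreviation "fixed_ratio U \<equiv> real (cmat.dim (fixed_by R H U)) / real (cmat.dim U)"

lemma space_haar: "space \<mu> = carrier G"
  using hp by (simp add: haar_prob_def)

lemma R_cont: "continuous_map T euclidean R"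
  and R_unitary: "g \<in> carrier G \<Longrightarrow> unitary (R g)"
  and R_mult: "g \<in> carrier G \<Longrightarrow> k \<in> carrier G \<Longrightarrow> R (g \<otimes>\<^bsub>G\<^esub> k) = R g ** R k"
  using rep by (auto simp: cont_unitary_rep_def)

lemma H_carrier: "h \<in> H \<Longrightarrow> h \<in> carrier G"
  using sub subgroup.mem_carrier by metis

lemma fb: "fourier_basis G R W Ws"
  using nd by (simp add: NDCSE_def CSE_def)

text \<open>\<open>cont_unitary_rep\<close> asks for multiplicativity, so R 1 is idempotent; being
  unitary, it can be cancelled.\<close>

lemma R_one: "R \<one>\<^bsub>G\<^esub> = mat 1"
proof -
  have "R \<one>\<^bsub>G\<^esub> = adj (R \<one>\<^bsub>G\<^esub>) ** R \<one>\<^bsub>G\<^esub> ** R \<one>\<^bsub>G\<^esub>"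
    using R_unitary[OF G.one_closed] by (simp add: unitary_def)
  also have "\<dots> = adj (R \<one>\<^bsub>G\<^esub>) ** R \<one>\<^bsub>G\<^esub>"
    using R_mult[OF G.one_closed G.one_closed] by (simp add: matrix_mul_assoc[symmetric])
  finally show ?thesis using R_unitary[OF G.one_closed] by (simp add: unitary_def)
qed

lemma lact_mult: "g \<in> carrier G \<Longrightarrow> k \<in> carrier G \<Longrightarrow> lact R (g \<otimes>\<^bsub>G\<^esub> k) X = lact R g (lact R k X)"
  by (simp add: lact_def R_mult adj_mult matrix_mul_assoc)

lemma lact_one: "lact R \<one>\<^bsub>G\<^esub> X = X"
proof -
  have "adj (mat 1 :: complex^'n^'n) = mat 1" by (simp add: adj_def mat_def vec_eq_iff)
  then show ?thesis by (simp add: lact_def R_one)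
qed

lemma lact_inv: "g \<in> carrier G \<Longrightarrow> lact R g (lact R (inv\<^bsub>G\<^esub> g) X) = X"
  by (simp add: lact_mult[symmetric] lact_one)

lemma hs_inner_lact: "g \<in> carrier G \<Longrightarrow> hs_inner (lact R g X) (lact R g Y) = hs_inner X Y"
  by (intro hs_inner_lact_unitary R_unitary)

lemma hs_inner_lact_right:
  "g \<in> carrier G \<Longrightarrow> hs_inner X (lact R g Y) = hs_inner (lact R (inv\<^bsub>G\<^esub> g) X) Y"
  by (metis hs_inner_lact lact_inv)

lemma hs_inner_lact_left:
  "g \<in> carrier G \<Longrightarrow> hs_inner (lact R g Y) X = hs_inner Y (lact R (inv\<^bsub>G\<^esub> g) X)"
  by (metis hs_inner_lact lact_inv)

lemma inv_LD_D:
  assumes "inv_LD U"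
  shows inv_LD_subspace: "cmat.subspace U" and inv_LD_subset: "U \<subseteq> LD Ws"
    and inv_LD_lact: "g \<in> carrier G \<Longrightarrow> X \<in> U \<Longrightarrow> lact R g X \<in> U"
  using assms by (auto simp: invariant_sub_def)

lemma irr_inv: "irr_LD U \<Longrightarrow> inv_LD U"
  by (simp add: irred_sub_def)

lemma irr_cases: "irr_LD U \<Longrightarrow> inv_LD U' \<Longrightarrow> U' \<subseteq> U \<Longrightarrow> U' = {0} \<or> U' = U"
  by (simp add: irred_sub_def)

lemma inv_LD_self: "inv_LD (LD Ws)"
  using LD_invariant[OF fb] LD_subspace by (auto simp: invariant_sub_def)

text \<open>By unitarity g passes to the other side as its inverse and keeps Y in U. Thus orthogonal
  complements of submodules are invariant.\<close>

lemma lact_orthogonal: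
  assumes "inv_LD U" "g \<in> carrier G" "\<And>Y. Y \<in> U \<Longrightarrow> hs_inner Y Z = 0" "Y \<in> U"
  shows "hs_inner Y (lact R g Z) = 0"
  using assms by (simp add: hs_inner_lact_right inv_LD_lact)

lemma hs_proj_lact:
  assumes U: "inv_LD U" and g: "g \<in> carrier G"
  shows "hs_proj U (lact R g X) = lact R g (hs_proj U X)"
proof (rule hs_proj_eqI)
  show s: "cmat.subspace U" using U by (rule inv_LD_subspace)
  show "lact R g (hs_proj U X) \<in> U" using U g hs_proj_in[OF s] by (intro inv_LD_lact) auto
  fix Z assume "Z \<in> U"
  then show "hs_inner Z (lact R g X - lact R g (hs_proj U X)) = 0"
    unfolding lact.diff[symmetric] using hs_proj_orth[OF s] by (intro lact_orthogonal[OF U g])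
qed

section \<open>The measurement channel as an intertwiner\<close>

abbreviation "LDH \<equiv> fixed_by R H (LD Ws)"

lemma LDH_subspace: "cmat.subspace LDH"
  by (intro fixed_by_subspace LD_subspace)

lemma dephase_proj: "dephase W X = hs_proj LDH X"
  using nd by (rule dephase_eq_hs_proj) (auto intro: R_unitary H_carrier)

lemma dephase_linear: "Vector_Spaces.linear cscale cscale (dephase W)"
proof -
  have "dephase W = hs_proj LDH" by (rule ext) (rule dephase_proj)
  then show ?thesis using hs_proj_linear[OF LDH_subspace] by simp
qed

text \<open>The projector onto an invariant \<open>U\<close> is an intertwiner, so it preserves \<open>H\<close>-fixed vectors and
  hence commutes with the projector \<open>dephase W\<close> onto them.\<close>
lemma dephase_invariant:
  assumes U: "inv_LD U" and X: "X \<in> U"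
  shows "dephase W X \<in> U"
proof -
  note s = inv_LD_subspace[OF U]
  define P where "P = hs_proj U (dephase W X)"
  define D where "D = dephase W X - P"
  have dX: "dephase W X \<in> LDH" unfolding dephase_proj by (rule hs_proj_in[OF LDH_subspace])
  have PU: "P \<in> U" unfolding P_def by (rule hs_proj_in[OF s])
  have "P \<in> LDH"
    using dX PU inv_LD_subset[OF U] hs_proj_lact[OF U H_carrier, of _ "dephase W X"]
    by (auto simp: fixed_by_def P_def)
  then have D: "D \<in> LDH" unfolding D_def using dX LDH_subspace by (intro cmat.subspace_diff)
  have DU: "hs_inner D Y = 0" if "Y \<in> U" for Y
    using hs_proj_orth[OF s that] hs_inner_eq_0_commute unfolding D_def P_def by blast
  have "hs_inner D (X - dephase W X) = 0"
    unfolding dephase_proj by (rule hs_proj_orth[OF LDH_subspace D])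
  then have "hs_inner D (dephase W X) = 0" using DU[OF X] by (simp add: hs_inner_diff_right)
  then have "hs_inner D D = 0" using DU[OF PU] unfolding D_def by (simp add: hs_inner_diff_right)
  then have "dephase W X = P" by (simp add: D_def)
  then show ?thesis using PU by simp
qed

lemma hs_inner_M: "hs_inner Z (M X) = (\<integral>g. hs_inner (lact R g Z) (dephase W (lact R g X)) \<partial>\<mu>)"
  by (rule hs_inner_meas_channel[OF cg hp rep])

lemma integrand_integrable: "integrable \<mu> (\<lambda>g. hs_inner (lact R g Z) (dephase W (lact R g X)))"
  by (intro haar_integrable[OF cg hp] continuous_map_lact_dephase R_cont)

lemma M_linear: "Vector_Spaces.linear cscale cscale M"
proof -
  interpret d: Vector_Spaces.linear cscale cscale "dephase W" by (rule dephase_linear)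
  have "M (X + Y) = M X + M Y" for X Y
    by (rule hs_inner_eqI)
      (simp add: hs_inner_M hs_inner_add_right lact.add d.add integrand_integrable)
  moreover have "M (cscale c X) = cscale c (M X)" for c X
    by (rule hs_inner_eqI)
      (simp add: hs_inner_M hs_inner_cscale_right lact.scale d.scale integrand_integrable)
  ultimately show ?thesis by (simp add: Vector_Spaces.linear_iff cmat.vector_space_axioms)
qed

sublocale M: Vector_Spaces.linear cscale cscale M by (rule M_linear)

text \<open>Translates of X stay orthogonal to L^D, and dephasing kills them because it projects
  onto a subspace of L^D. The integrand vanishes for each g.\<close>

lemma M_orthogonal_LD:
  assumes X: "\<And>Y. Y \<in> LD Ws \<Longrightarrow> hs_inner Y X = 0"
  shows "M X = 0"
proof (rule hs_inner_eqI)
  fix Z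
  have "dephase W (lact R g X) = 0" if "g \<in> carrier G" for g
    unfolding dephase_proj using LDH_subspace lact_orthogonal[OF inv_LD_self that X]
    by (intro hs_proj_eq_0) (auto simp: fixed_by_def)
  then have "(\<integral>g. hs_inner (lact R g Z) (dephase W (lact R g X)) \<partial>\<mu>) = (\<integral>g. 0 \<partial>\<mu>)"
    by (intro Bochner_Integration.integral_cong) (auto simp: space_haar)
  then show "hs_inner Z (M X) = hs_inner Z 0" by (simp add: hs_inner_M)
qed

text \<open>Against a test operator Z orthogonal to U the integrand vanishes pointwise: translation
  and dephasing keep X in U, and translation keeps Z in the complement.\<close>

lemma M_invariant:
  assumes U: "inv_LD U" and X: "X \<in> U"
  shows "M X \<in> U"
proof (rule hs_double_orthogonal_in_subspace[OF inv_LD_subspace[OF U]])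
  fix Z assume Z: "\<And>Y. Y \<in> U \<Longrightarrow> hs_inner Y Z = 0"
  have "hs_inner (lact R g Z) (dephase W (lact R g X)) = 0" if g: "g \<in> carrier G" for g
    using lact_orthogonal[OF U g Z dephase_invariant[OF U inv_LD_lact[OF U g X]]]
      hs_inner_eq_0_commute by blast
  then have "(\<integral>g. hs_inner (lact R g Z) (dephase W (lact R g X)) \<partial>\<mu>) = (\<integral>g. 0 \<partial>\<mu>)"
    by (intro Bochner_Integration.integral_cong) (auto simp: space_haar)
  then show "hs_inner Z (M X) = 0" by (simp add: hs_inner_M)
qed

lemma M_lact:
  assumes k: "k \<in> carrier G"
  shows "M (lact R k X) = lact R k (M X)"
proof (rule hs_inner_eqI)
  fix Z
  \<comment> \<open>With this Z' both arguments of the pairing depend on g and k only through their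
    product, so right invariance applies.\<close>
  define Z' where "Z' = lact R (inv\<^bsub>G\<^esub> k) Z"
  have "hs_inner Z (M (lact R k X))
      = (\<integral>g. hs_inner (lact R (g \<otimes>\<^bsub>G\<^esub> k) Z') (dephase W (lact R (g \<otimes>\<^bsub>G\<^esub> k) X)) \<partial>\<mu>)"
    unfolding hs_inner_M Z'_def using k
    by (intro Bochner_Integration.integral_cong) (auto simp: space_haar lact_mult lact_inv)
  also have "\<dots> = hs_inner Z' (M X)"
    unfolding hs_inner_M
    by (rule haar_integral_right_translate[OF cg hp continuous_map_lact_dephase[OF R_cont] k])
  also have "\<dots> = hs_inner Z (lact R k (M X))" using k by (simp add: Z'_def hs_inner_lact_right)
  finally show "hs_inner Z (M (lact R k X)) = hs_inner Z (lact R k (M X))" .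
qed

text \<open>M has an eigenvector in U, and since M is an intertwiner the eigenspace inside U is a
  nonzero submodule, hence all of U.\<close>

lemma M_schur:
  assumes U: "irr_LD U"
  shows "\<exists>c. \<forall>X\<in>U. M X = cscale c X"
proof -
  note iU = irr_inv[OF U]
  note s = inv_LD_subspace[OF iU]
  have "U \<noteq> {0}" using U by (simp add: irred_sub_def)
  then obtain X0 c where X0: "X0 \<in> U" "X0 \<noteq> 0" "M X0 = cscale c X0"
    using cmat_eigenvector_exists[OF M_linear s M_invariant[OF iU]] by blast
  define E where "E = {X \<in> U. M X = cscale c X}"
  have "cmat.subspace E"
    using s unfolding E_def
    by (auto simp: cmat.subspace_def M.zero M.add M.scale cmat.scale_right_distrib mult.commute)
  then have "inv_LD E"
    using inv_LD_subset[OF iU] inv_LD_lact[OF iU]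
    by (auto simp: invariant_sub_def E_def M_lact lact.scale)
  then have "E = {0} \<or> E = U" using irr_cases[OF U] by (auto simp: E_def)
  then show ?thesis using X0 by (auto simp: E_def)
qed

text \<open>The sum is the trace over U of the projector onto the H-fixed vectors, conjugated by g.
  After expanding in an orthonormal basis F of these vectors and exchanging the sums, each f
  contributes Parseval for the unit vector obtained from f by the inverse of g, that is 1.\<close>

lemma trace_dephase:
  assumes U: "inv_LD U" and g: "g \<in> carrier G"
    and E: "hs_orthonormal E" "finite E" "E \<subseteq> U" "\<forall>X\<in>U. (\<Sum>e\<in>E. cscale (hs_inner e X) e) = X"
  shows "(\<Sum>e\<in>E. hs_inner (lact R g e) (dephase W (lact R g e))) = of_nat (cmat.dim (fixed_by R H U))"
proof -
  note s = inv_LD_subspace[OF U]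
  obtain F where F: "hs_orthonormal F" "finite F" "F \<subseteq> fixed_by R H U"
    "cmat.span F = fixed_by R H U" "card F = cmat.dim (fixed_by R H U)"
    "\<forall>X\<in>fixed_by R H U. (\<Sum>f\<in>F. cscale (hs_inner f X) f) = X"
    by (rule hs_onb_exists[OF fixed_by_subspace[OF s]])
  have *: "hs_inner Y (dephase W Y) = (\<Sum>f\<in>F. hs_inner f Y * hs_inner Y f)" if Y: "Y \<in> U" for Y
  proof -
    \<comment> \<open>The dephased operator lies both in U and in the fixed part of L^D, so the
      basis F suffices to expand it.\<close>
    have "dephase W Y \<in> fixed_by R H U"
      using dephase_invariant[OF U Y] hs_proj_in[OF LDH_subspace, of Y]
      by (auto simp: fixed_by_def dephase_proj)
    then have "dephase W Y = (\<Sum>f\<in>F. cscale (hs_inner f (dephase W Y)) f)" using F(6) by simp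
    also have "\<dots> = (\<Sum>f\<in>F. cscale (hs_inner f Y) f)"
    proof (intro sum.cong refl)
      fix f assume "f \<in> F"
      then have "f \<in> LDH" using F(3) inv_LD_subset[OF U] by (auto simp: fixed_by_def)
      then have "dephase W f = f" by (simp add: dephase_proj hs_proj_id LDH_subspace)
      then show "cscale (hs_inner f (dephase W Y)) f = cscale (hs_inner f Y) f"
        by (simp add: hs_inner_dephase)
    qed
    finally have "hs_inner Y (dephase W Y) = hs_inner Y (\<Sum>f\<in>F. cscale (hs_inner f Y) f)" by simp
    then show ?thesis by (simp add: hs_inner_sum_right hs_inner_cscale_right)
  qed
  have "(\<Sum>e\<in>E. hs_inner (lact R g e) (dephase W (lact R g e)))
      = (\<Sum>e\<in>E. \<Sum>f\<in>F. hs_inner f (lact R g e) * hs_inner (lact R g e) f)"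
    using E(3) inv_LD_lact[OF U g] by (intro sum.cong * refl) auto
  also have "\<dots> = (\<Sum>f\<in>F. \<Sum>e\<in>E. hs_inner f (lact R g e) * hs_inner (lact R g e) f)" by (rule sum.swap)
  also have "\<dots> = (\<Sum>f\<in>F. 1)"
  proof (intro sum.cong refl)
    fix f assume f: "f \<in> F"
    define f' where "f' = lact R (inv\<^bsub>G\<^esub> g) f"
    have "f \<in> U" using f F(3) by (auto simp: fixed_by_def)
    then have "f' \<in> U" unfolding f'_def using g by (intro inv_LD_lact[OF U]) auto
    have "(\<Sum>e\<in>E. hs_inner f (lact R g e) * hs_inner (lact R g e) f) = (\<Sum>e\<in>E. hs_inner f' e * hs_inner e f')"
      by (simp only: f'_def hs_inner_lact_right[OF g, of f] hs_inner_lact_left[OF g, of _ f])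
    also have "\<dots> = hs_inner f' f'" using E \<open>f' \<in> U\<close> by (intro hs_parseval) auto
    also have "\<dots> = hs_inner f f" unfolding f'_def using g by (intro hs_inner_lact) auto
    also have "\<dots> = 1" using f F(1) by (simp add: hs_orthonormal_def)
    finally show "(\<Sum>e\<in>E. hs_inner f (lact R g e) * hs_inner (lact R g e) f) = 1" .
  qed
  finally show ?thesis using F(5) by simp
qed

text \<open>Over an orthonormal basis of U the Schur scalar c has trace c * dim U, and the trace
  under the integral is constant in g with a probability measure.\<close>

lemma M_irreducible:
  assumes U: "irr_LD U" and X: "X \<in> U"
  shows "M X = cscale (complex_of_real (fixed_ratio U)) X"
proof -
  note iU = irr_inv[OF U]
  note s = inv_LD_subspace[OF iU]
  obtain c where c: "\<And>X. X \<in> U \<Longrightarrow> M X = cscale c X" using M_schur[OF U] by blast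
  obtain E where E: "hs_orthonormal E" "finite E" "E \<subseteq> U" "cmat.span E = U" "card E = cmat.dim U"
    "\<forall>X\<in>U. (\<Sum>e\<in>E. cscale (hs_inner e X) e) = X"
    by (rule hs_onb_exists[OF s])
  \<comment> \<open>An empty basis would span only 0; hence dim U is nonzero and may be divided
    by.\<close>
  have "E \<noteq> {}" using E(4) U by (auto simp: irred_sub_def)
  then have d0: "cmat.dim U \<noteq> 0" using E(2,5) by (metis card_0_eq)
  have "c * of_nat (cmat.dim U) = (\<Sum>e\<in>E. hs_inner e (M e))"
  proof -
    have "(\<Sum>e\<in>E. hs_inner e (M e)) = (\<Sum>e\<in>E. c)"
      using E(1,3) by (intro sum.cong refl) (auto simp: c hs_inner_cscale_right hs_orthonormal_def)
    then show ?thesis using E(5) by (simp add: mult.commute)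
  qed
  also have "\<dots> = (\<integral>g. (\<Sum>e\<in>E. hs_inner (lact R g e) (dephase W (lact R g e))) \<partial>\<mu>)"
    by (simp add: hs_inner_M integrand_integrable)
  also have "\<dots> = (\<integral>g. of_nat (cmat.dim (fixed_by R H U)) \<partial>\<mu>)"
    using trace_dephase[OF iU _ E(1-3,6)]
    by (intro Bochner_Integration.integral_cong) (auto simp: space_haar)
  also have "\<dots> = of_nat (cmat.dim (fixed_by R H U))" by (simp add: prob_space)
  finally have "c = complex_of_real (fixed_ratio U)" using d0 by (simp add: field_simps)
  then show ?thesis using c[OF X] by simp
qed

section \<open>Isotypic components\<close>

lemma iso_refl: "g_iso U U"
  unfolding iso_sub_def using cmat.linear_id by (intro exI[of _ id]) (auto simp: bij_betw_def)

lemma iso_trans: "g_iso U V \<Longrightarrow> g_iso V V' \<Longrightarrow> g_iso U V'"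
  unfolding iso_sub_def
proof (elim exE conjE)
  fix f f'
  assume f: "Vector_Spaces.linear cscale cscale f" "bij_betw f U V"
    "\<forall>g\<in>carrier G. \<forall>x\<in>U. f (lact R g x) = lact R g (f x)"
    and f': "Vector_Spaces.linear cscale cscale f'" "bij_betw f' V V'"
    "\<forall>g\<in>carrier G. \<forall>x\<in>V. f' (lact R g x) = lact R g (f' x)"
  show "\<exists>f. Vector_Spaces.linear cscale cscale f \<and> bij_betw f U V' \<and>
       (\<forall>g\<in>carrier G. \<forall>x\<in>U. f (lact R g x) = lact R g (f x))"
    using Vector_Spaces.linear_compose[OF f(1) f'(1)] bij_betw_trans[OF f(2) f'(2)] f f'
    by (intro exI[of _ "f' \<circ> f"]) (auto simp: bij_betw_def)
qed

text \<open>\<open>iso_sub\<close> demands a map that is linear on the whole operator space, so the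
  inverse is taken from a global linear map that is a left inverse of f on U.\<close>

lemma iso_sym:
  assumes U: "inv_LD U" and "g_iso U V"
  shows "g_iso V U"
proof -
  obtain f where f: "Vector_Spaces.linear cscale cscale f" "bij_betw f U V"
    "\<forall>g\<in>carrier G. \<forall>x\<in>U. f (lact R g x) = lact R g (f x)"
    using assms(2) by (auto simp: iso_sub_def)
  obtain h where h: "Vector_Spaces.linear cscale cscale h" "\<forall>x\<in>U. h (f x) = x"
    using cmat.linear_exists_left_inverse_on[OF f(1) inv_LD_subspace[OF U]] f(2)
    by (auto simp: bij_betw_def)
  have "bij_betw h V U" using f(2) h(2) by (auto simp: bij_betw_def inj_on_def image_iff)
  moreover have "h (lact R g y) = lact R g (h y)" if g: "g \<in> carrier G" and "y \<in> V" for g y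
  proof -
    obtain x where x: "x \<in> U" "y = f x" using f(2) \<open>y \<in> V\<close> by (auto simp: bij_betw_def)
    then show ?thesis using f(3) h(2) g inv_LD_lact[OF U g x(1)] by metis
  qed
  ultimately show ?thesis using h(1) by (auto simp: iso_sub_def)
qed

text \<open>An intertwiner maps H-fixed vectors to H-fixed vectors, and injectivity gives the
  converse. All copies of one irreducible thus share the value that \<open>coeffH\<close> computes
  from a chosen one.\<close>

lemma iso_fixed_ratio:
  assumes U: "inv_LD U" and V: "inv_LD V" and g_iso: "g_iso U V"
  shows "fixed_ratio U = fixed_ratio V"
proof -
  obtain f where f: "Vector_Spaces.linear cscale cscale f" "inj_on f U" "f ` U = V"
    "\<forall>g\<in>carrier G. \<forall>x\<in>U. f (lact R g x) = lact R g (f x)"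
    using g_iso by (auto simp: iso_sub_def bij_betw_def)
  have dim: "cmat.dim (f ` S) = cmat.dim S" if "cmat.subspace S" "S \<subseteq> U" for S
    using that f(1,2) by (intro cmat.dim_image_eq) (auto intro: inj_on_subset simp: cmat.span_eq_iff[THEN iffD2])
  have "f ` fixed_by R H U = fixed_by R H V"
  proof (intro equalityI subsetI)
    fix y assume "y \<in> f ` fixed_by R H U"
    then show "y \<in> fixed_by R H V" using f(3,4) H_carrier by (fastforce simp: fixed_by_def)
  next
    fix y assume y: "y \<in> fixed_by R H V"
    then obtain x where x: "x \<in> U" "y = f x" using f(3) by (auto simp: fixed_by_def)
    have "lact R h x = x" if h: "h \<in> H" for h
    proof (rule inj_onD[OF f(2)])
      show "f (lact R h x) = f x" using y x f(4) h H_carrier by (auto simp: fixed_by_def)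
    qed (use x inv_LD_lact[OF U] h H_carrier in auto)
    then show "y \<in> f ` fixed_by R H U" using x by (auto simp: fixed_by_def)
  qed
  moreover have "cmat.dim V = cmat.dim U" using dim[OF inv_LD_subspace[OF U]] f(3) by simp
  moreover have "cmat.dim (f ` fixed_by R H U) = cmat.dim (fixed_by R H U)"
    by (rule dim[OF fixed_by_subspace[OF inv_LD_subspace[OF U]]]) (auto simp: fixed_by_def)
  ultimately show ?thesis by simp
qed

text \<open>Schur's lemma for the projector onto V restricted to U: kernel and image are submodules,
  so a nonzero restriction would be an isomorphism.\<close>

lemma non_iso_orthogonal:
  assumes U: "irr_LD U" and V: "irr_LD V" and "\<not> g_iso U V" and X: "X \<in> U" and Y: "Y \<in> V"
  shows "hs_inner X Y = 0"
proof -
  note iU = irr_inv[OF U] and iV = irr_inv[OF V]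
  note sU = inv_LD_subspace[OF iU] and sV = inv_LD_subspace[OF iV]
  interpret P: Vector_Spaces.linear cscale cscale "hs_proj V" by (rule hs_proj_linear[OF sV])
  have "inv_LD (hs_proj V ` U)"
    unfolding invariant_sub_def
    using P.subspace_image[OF sU] hs_proj_in[OF sV] inv_LD_subset[OF iV] inv_LD_lact[OF iU]
    by (auto simp: hs_proj_lact[OF iV, symmetric])
  then have image: "hs_proj V ` U = {0} \<or> hs_proj V ` U = V"
    using irr_cases[OF V] hs_proj_in[OF sV] by blast
  define K where "K = {X \<in> U. hs_proj V X = 0}"
  have "cmat.subspace K"
    using sU by (auto simp: K_def cmat.subspace_def P.zero P.add P.scale)
  then have "inv_LD K"
    using inv_LD_subset[OF iU] inv_LD_lact[OF iU]
    by (auto simp: invariant_sub_def K_def hs_proj_lact[OF iV])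
  then have "K = {0} \<or> K = U" using irr_cases[OF U] by (auto simp: K_def)
  then have "K = U"
  proof
    assume K: "K = {0}"
    show ?thesis
    proof (cases "hs_proj V ` U = {0}")
      case True
      then show ?thesis by (auto simp: K_def)
    next
      case False
      then have "hs_proj V ` U = V" using image by blast
      moreover have "inj_on (hs_proj V) U"
      proof (rule inj_onI)
        fix x y assume "x \<in> U" "y \<in> U" "hs_proj V x = hs_proj V y"
        then have "x - y \<in> K" using sU by (simp add: K_def P.diff cmat.subspace_diff)
        then show "x = y" using K by simp
      qed
      ultimately have "g_iso U V"
        unfolding iso_sub_def using hs_proj_linear[OF sV] hs_proj_lact[OF iV]
        by (intro exI[of _ "hs_proj V"]) (auto simp: bij_betw_def)
      then show ?thesis using assms(3) by simp
    qed
  qed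
  then have "hs_proj V X = 0" using X by (auto simp: K_def)
  then have "hs_inner Y X = 0" using hs_proj_orth[OF sV Y, of X] by simp
  then show ?thesis using hs_inner_eq_0_commute by blast
qed

lemma Iso_rep:
  assumes "C \<in> Iso"
  obtains U where "irr_LD U" "C = iso_comp cscale (carrier G) (lact R) (LD Ws) U"
  using assms by (auto simp: isotypics_def)

lemma Iso_subspace: "C \<in> Iso \<Longrightarrow> cmat.subspace C"
  by (auto simp: isotypics_def iso_comp_def)

lemma irr_subset_iso_comp: "irr_LD U \<Longrightarrow> U \<subseteq> iso_comp cscale (carrier G) (lact R) (LD Ws) U"
  unfolding iso_comp_def using iso_refl by (blast intro: cmat.span_base)

lemma iso_comp_eq:
  assumes U: "irr_LD U" and V: "irr_LD V" and "g_iso U V"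
  shows "iso_comp cscale (carrier G) (lact R) (LD Ws) U = iso_comp cscale (carrier G) (lact R) (LD Ws) V"
proof -
  have "g_iso U U' \<longleftrightarrow> g_iso V U'" for U'
    using iso_trans iso_sym[OF irr_inv[OF U]] assms(3) by blast
  then show ?thesis by (simp add: iso_comp_def)
qed

text \<open>Distinct components have non-isomorphic representatives, since isomorphic ones yield the
  same span; orthogonality then extends from the generating irreducibles to both spans.\<close>

lemma Iso_orthogonal:
  assumes "C \<in> Iso" "C' \<in> Iso" "C \<noteq> C'" "X \<in> C" "X' \<in> C'"
  shows "hs_inner X X' = 0"
proof -
  obtain U where U: "irr_LD U" "C = iso_comp cscale (carrier G) (lact R) (LD Ws) U"
    using assms(1) by (rule Iso_rep)
  obtain U' where U': "irr_LD U'" "C' = iso_comp cscale (carrier G) (lact R) (LD Ws) U'"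
    using assms(2) by (rule Iso_rep)
  have not_iso: "\<not> g_iso U U'" using iso_comp_eq U U' assms(3) by blast
  have orth: "hs_inner Y Y' = 0"
    if V: "irr_LD V" "g_iso U V" "Y \<in> V" and V': "irr_LD V'" "g_iso U' V'" "Y' \<in> V'" for V V' Y Y'
  proof -
    have "\<not> g_iso V V'"
      using not_iso iso_trans iso_sym[OF irr_inv[OF U'(1)] V'(2)] V(2) by blast
    then show ?thesis using non_iso_orthogonal V V' by blast
  qed
  have 1: "hs_inner Y X' = 0" if "irr_LD V" "g_iso U V" "Y \<in> V" for V Y
    using assms(5) unfolding U'(2) iso_comp_def
    by (induction rule: cmat.span_induct_alt)
      (use orth[OF that] in \<open>auto simp: hs_inner_add_right hs_inner_cscale_right\<close>)
  show ?thesis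
    using assms(4) unfolding U(2) iso_comp_def
    by (induction rule: cmat.span_induct_alt)
      (use 1 in \<open>auto simp: hs_inner_add_left hs_inner_cscale_left\<close>)
qed

text \<open>One unit vector from each component gives an injectively indexed orthonormal family,
  which is finite. For infinite \<open>Iso\<close> the sums over it would be 0 by
  convention.\<close>

lemma Iso_finite: "finite Iso"
proof -
  have "\<exists>u\<in>C. hs_inner u u = 1" if C: "C \<in> Iso" for C
  proof -
    obtain U where U: "irr_LD U" "C = iso_comp cscale (carrier G) (lact R) (LD Ws) U"
      using C by (rule Iso_rep)
    obtain B where B: "hs_orthonormal B" "finite B" "B \<subseteq> C" "cmat.span B = C"
      "card B = cmat.dim C" "\<forall>X\<in>C. (\<Sum>b\<in>B. cscale (hs_inner b X) b) = X"
      by (rule hs_onb_exists[OF Iso_subspace[OF C]])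
    have "U \<noteq> {0}" using U(1) by (simp add: irred_sub_def)
    moreover have "0 \<in> U" by (rule cmat.subspace_0[OF inv_LD_subspace[OF irr_inv[OF U(1)]]])
    ultimately have "C \<noteq> {0}" using irr_subset_iso_comp[OF U(1)] U(2) by blast
    then obtain b where b: "b \<in> B" using B(4) by (metis cmat.span_empty equals0I)
    then have "hs_inner b b = 1" using B(1) by (simp add: hs_orthonormal_def)
    then show ?thesis using b B(3) by blast
  qed
  then obtain u where u: "\<And>C. C \<in> Iso \<Longrightarrow> u C \<in> C \<and> hs_inner (u C) (u C) = 1" by metis
  have orth: "hs_inner (u C) (u C') = 0" if "C \<in> Iso" "C' \<in> Iso" "C \<noteq> C'" for C C'
    using that u Iso_orthogonal by blast
  have "inj_on u Iso" using u orth by (metis inj_onI zero_neq_one)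
  moreover have "hs_orthonormal (u ` Iso)"
    unfolding hs_orthonormal_def
  proof (intro ballI)
    fix b b' assume "b \<in> u ` Iso" "b' \<in> u ` Iso"
    then obtain C C' where C: "C \<in> Iso" "b = u C" "C' \<in> Iso" "b' = u C'" by blast
    show "hs_inner b b' = (if b = b' then 1 else 0)"
    proof (cases "C = C'")
      case True
      then show ?thesis using C u by simp
    next
      case False
      then have "hs_inner b b' = 0" using orth C by simp
      moreover have "b \<noteq> b'" using calculation u[OF C(1)] C(2) by auto
      ultimately show ?thesis by simp
    qed
  qed
  ultimately show ?thesis by (metis hs_orthonormal_finite finite_imageD)
qed

section \<open>Irreducible submodules and components exhaust L^D\<close>

lemma irr_exists:
  assumes N: "inv_LD N" "N \<noteq> {0}"
  shows "\<exists>U\<subseteq>N. irr_LD U"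
proof -
  \<comment> \<open>Least dimension is enough for irreducibility: a submodule of U whose dimension
    is not smaller equals U.\<close>
  obtain U where U: "inv_LD U" "U \<noteq> {0}" "U \<subseteq> N"
    and min: "\<And>V. inv_LD V \<and> V \<noteq> {0} \<and> V \<subseteq> N \<Longrightarrow> cmat.dim U \<le> cmat.dim V"
    using ex_has_least_nat[of "\<lambda>V. inv_LD V \<and> V \<noteq> {0} \<and> V \<subseteq> N" N cmat.dim] N by auto
  have "V = {0} \<or> V = U" if V: "inv_LD V" "V \<subseteq> U" for V
  proof (cases "V = {0}")
    case False
    then have "cmat.dim U \<le> cmat.dim V" using V U(3) by (intro min) auto
    then show ?thesis
      using cmat.subspace_dim_equal V U(1) inv_LD_subspace by blast
  qed simp
  then have "irr_LD U" using U(1,2) unfolding irred_sub_def by blast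
  then show ?thesis using U(3) by blast
qed

text \<open>The common orthogonal complement N of all irreducible submodules is itself a submodule;
  if nonzero, it would contain an irreducible one, orthogonal to itself. This takes the place of
  choosing a decomposition into irreducibles.\<close>

lemma orthogonal_irr_eq_0:
  assumes D: "D \<in> LD Ws" "\<And>U Z. irr_LD U \<Longrightarrow> Z \<in> U \<Longrightarrow> hs_inner Z D = 0"
  shows "D = 0"
proof -
  define N where "N = {Y \<in> LD Ws. \<forall>U Z. irr_LD U \<longrightarrow> Z \<in> U \<longrightarrow> hs_inner Z Y = 0}"
  have "cmat.subspace N"
    using LD_subspace[of Ws]
    by (auto simp: N_def cmat.subspace_def hs_inner_add_right hs_inner_cscale_right)
  moreover have "lact R g Y \<in> N" if "g \<in> carrier G" "Y \<in> N" for g Y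
    using that inv_LD_lact[OF inv_LD_self] lact_orthogonal[OF irr_inv] by (auto simp: N_def)
  ultimately have "inv_LD N" by (auto simp: invariant_sub_def N_def)
  have "N = {0}"
  proof (rule ccontr)
    assume "N \<noteq> {0}"
    then obtain U where U: "U \<subseteq> N" "irr_LD U" using irr_exists[OF \<open>inv_LD N\<close>] by blast
    then have "hs_inner Z Z = 0" if "Z \<in> U" for Z using that unfolding N_def by blast
    then have "U \<subseteq> {0}" by auto
    moreover have "0 \<in> U" using U(2) cmat.subspace_0 inv_LD_subspace irr_inv by blast
    ultimately show False using U(2) by (auto simp: irred_sub_def)
  qed
  then show ?thesis using D by (auto simp: N_def)
qed

lemma Iso_subset_LD: "C \<in> Iso \<Longrightarrow> C \<subseteq> LD Ws"
proof -
  assume "C \<in> Iso"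
  then obtain U where "C = iso_comp cscale (carrier G) (lact R) (LD Ws) U" by (rule Iso_rep)
  moreover have "V \<subseteq> LD Ws" if "irr_LD V" for V
    by (rule inv_LD_subset[OF irr_inv[OF that]])
  then have "\<Union>{V. irr_LD V \<and> g_iso U V} \<subseteq> LD Ws" by blast
  then have "cmat.span (\<Union>{V. irr_LD V \<and> g_iso U V}) \<subseteq> LD Ws"
    using LD_subspace by (rule cmat.span_minimal)
  ultimately show ?thesis by (simp add: iso_comp_def)
qed

lemma hs_proj_Iso_orth:
  assumes "C \<in> Iso" "C' \<in> Iso" "C \<noteq> C'" "X \<in> C'"
  shows "hs_proj C X = 0"
  using assms Iso_orthogonal by (intro hs_proj_eq_0 Iso_subspace) auto

lemma LD_decomposition:
  assumes X: "X \<in> LD Ws"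
  shows "(\<Sum>C\<in>Iso. hs_proj C X) = X"
proof -
  define D where "D = X - (\<Sum>C\<in>Iso. hs_proj C X)"
  have "D = 0"
  proof (rule orthogonal_irr_eq_0)
    show "D \<in> LD Ws"
      unfolding D_def using X LD_subspace hs_proj_in[OF Iso_subspace] Iso_subset_LD
      by (intro cmat.subspace_diff cmat.subspace_sum) blast+
    fix U Z assume U: "irr_LD U" "Z \<in> U"
    define C where "C = iso_comp cscale (carrier G) (lact R) (LD Ws) U"
    have C: "C \<in> Iso" using U by (auto simp: isotypics_def C_def)
    have Z: "Z \<in> C" unfolding C_def using irr_subset_iso_comp[OF U(1)] U(2) by blast
    \<comment> \<open>Z lies in the component C, so it does not see the projections to other
      components; the projection to C pairs with Z as X does.\<close>
    have "(\<Sum>C'\<in>Iso. hs_inner Z (hs_proj C' X)) = hs_inner Z (hs_proj C X)"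
    proof (rule sum.remove[OF Iso_finite C, THEN trans])
      have "(\<Sum>C'\<in>Iso - {C}. hs_inner Z (hs_proj C' X)) = 0"
        using Iso_orthogonal[OF C _ _ Z] hs_proj_in[OF Iso_subspace] by (intro sum.neutral) blast
      then show "hs_inner Z (hs_proj C X) + (\<Sum>C'\<in>Iso - {C}. hs_inner Z (hs_proj C' X)) = hs_inner Z (hs_proj C X)"
        by simp
    qed
    then show "hs_inner Z D = 0"
      using hs_proj_orth[OF Iso_subspace[OF C] Z, of X]
      by (simp add: D_def hs_inner_diff_right hs_inner_sum_right)
  qed
  then show ?thesis by (simp add: D_def)
qed

section \<open>Diagonalisation of the measurement channel\<close>

abbreviation "a \<equiv> coeffH G R H Ws"

lemma coeffH_nonneg: "a C \<ge> 0"
  by (simp add: coeffH_def Let_def)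

text \<open>The set S of vectors from copies of U is left open, so that the lemma serves the
  components of L^D as well as those of the range of M, which a priori contain fewer copies.\<close>

lemma M_on_iso_class:
  assumes U: "irr_LD U"
    and S: "S \<subseteq> \<Union>{V. irr_LD V \<and> g_iso U V}" and X: "X \<in> cmat.span S"
  shows "M X = cscale (complex_of_real (fixed_ratio U)) X"
  using X
proof (induction rule: cmat.span_induct_alt)
  case base
  show ?case by (simp add: M.zero)
next
  case (step c x y)
  then obtain V where V: "irr_LD V" "g_iso U V" "x \<in> V" using S by blast
  have "M x = cscale (complex_of_real (fixed_ratio U)) x"
    using M_irreducible[OF V(1,3)] iso_fixed_ratio[OF irr_inv[OF U] irr_inv[OF V(1)] V(2)] by simp
  then show ?case using step
    by (simp add: M.add M.scale cmat.scale_right_distrib mult.commute)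
qed

lemma M_on_Iso:
  assumes C: "C \<in> Iso" and X: "X \<in> C"
  shows "M X = cscale (complex_of_real (a C)) X"
proof -
  \<comment> \<open>This repeats the choice made inside \<open>coeffH\<close>, so that the
    coefficient unfolds to the ratio for this U.\<close>
  define U where "U = (SOME U. irr_LD U \<and> iso_comp cscale (carrier G) (lact R) (LD Ws) U = C)"
  have "\<exists>U. irr_LD U \<and> iso_comp cscale (carrier G) (lact R) (LD Ws) U = C"
    using C by (auto simp: isotypics_def)
  then have U: "irr_LD U" "iso_comp cscale (carrier G) (lact R) (LD Ws) U = C"
    unfolding U_def by (metis (mono_tags, lifting) someI_ex)+
  have "a C = fixed_ratio U"
    by (simp add: coeffH_def Let_def U_def fixed_by_def)
  moreover have "X \<in> cmat.span (\<Union>{V. irr_LD V \<and> g_iso U V})"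
    using X U(2) by (simp add: iso_comp_def)
  ultimately show ?thesis using M_on_iso_class[OF U(1) subset_refl] by simp
qed

text \<open>The part of X orthogonal to L^D is annihilated by M and by the projector of each
  component; on the remaining part Y the channel acts componentwise.\<close>

lemma M_diagonal: "M X = (\<Sum>C\<in>Iso. cscale (complex_of_real (a C)) (hs_proj C X))"
proof -
  define Y where "Y = hs_proj (LD Ws) X"
  have Y: "Y \<in> LD Ws" unfolding Y_def by (rule hs_proj_in[OF LD_subspace])
  have orth: "hs_inner Z (X - Y) = 0" if "Z \<in> LD Ws" for Z
    unfolding Y_def by (rule hs_proj_orth[OF LD_subspace that])
  have "M X = M Y"
    using M_orthogonal_LD[OF orth] by (simp add: M.diff)
  also have "\<dots> = (\<Sum>C\<in>Iso. M (hs_proj C Y))"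
    using LD_decomposition[OF Y] by (metis M.sum)
  also have "\<dots> = (\<Sum>C\<in>Iso. cscale (complex_of_real (a C)) (hs_proj C X))"
  proof (intro sum.cong refl)
    fix C assume C: "C \<in> Iso"
    interpret P: Vector_Spaces.linear cscale cscale "hs_proj C"
      by (rule hs_proj_linear[OF Iso_subspace[OF C]])
    have "hs_proj C (X - Y) = 0"
      using orth Iso_subset_LD[OF C] by (intro hs_proj_eq_0 Iso_subspace[OF C]) blast
    then have "hs_proj C Y = hs_proj C X" by (simp add: P.diff)
    then show "M (hs_proj C Y) = cscale (complex_of_real (a C)) (hs_proj C X)"
      using M_on_Iso[OF C hs_proj_in[OF Iso_subspace[OF C]]] by simp
  qed
  finally show ?thesis .
qed

section \<open>Inverse on the visible space, range and centralizing property\<close>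

lemma hs_proj_M:
  assumes C: "C \<in> Iso"
  shows "hs_proj C (M X) = cscale (complex_of_real (a C)) (hs_proj C X)"
proof -
  interpret P: Vector_Spaces.linear cscale cscale "hs_proj C"
    by (rule hs_proj_linear[OF Iso_subspace[OF C]])
  have "hs_proj C (M X) = (\<Sum>C'\<in>Iso. cscale (complex_of_real (a C')) (hs_proj C (hs_proj C' X)))"
    by (simp add: M_diagonal P.sum P.scale)
  also have "\<dots> = (\<Sum>C'\<in>Iso. if C' = C then cscale (complex_of_real (a C)) (hs_proj C X) else 0)"
    using hs_proj_Iso_orth[OF C] hs_proj_in[OF Iso_subspace] hs_proj_id[OF Iso_subspace[OF C]] C
    by (intro sum.cong refl) auto
  finally show ?thesis using C Iso_finite by simp
qed

text \<open>Applying M twice produces the square of each coefficient, of which the weight cancels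
  one factor; omitted components have coefficient 0 by nonnegativity. The identity is both the left
  inverse on the range and an expression of M X through the positive components.\<close>

lemma sum_positive_proj_M:
  "(\<Sum>C\<in>{C\<in>Iso. a C > 0}. cscale (complex_of_real (1 / a C)) (hs_proj C (M (M X)))) = M X"
proof -
  have "(\<Sum>C\<in>{C\<in>Iso. a C > 0}. cscale (complex_of_real (1 / a C)) (hs_proj C (M (M X))))
      = (\<Sum>C\<in>{C\<in>Iso. a C > 0}. cscale (complex_of_real (a C)) (hs_proj C X))"
    by (intro sum.cong refl) (auto simp: hs_proj_M)
  also have "\<dots> = (\<Sum>C\<in>Iso. cscale (complex_of_real (a C)) (hs_proj C X))"
  proof (rule sum.mono_neutral_left[OF Iso_finite])
    have "a C = 0" if "\<not> a C > 0" for C using that coeffH_nonneg[of C] by simp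
    then show "\<forall>C\<in>Iso - {C \<in> Iso. a C > 0}. cscale (complex_of_real (a C)) (hs_proj C X) = 0"
      by auto
  qed auto
  finally show ?thesis by (simp add: M_diagonal[symmetric])
qed

lemma range_M: "range M = cmat.span (\<Union>{C\<in>Iso. a C > 0})"
proof (intro equalityI subsetI)
  fix Y assume "Y \<in> range M"
  then obtain X where X: "Y = M X" by blast
  have "(\<Sum>C\<in>{C\<in>Iso. a C > 0}. cscale (complex_of_real (1 / a C)) (hs_proj C (M (M X))))
      \<in> cmat.span (\<Union>{C\<in>Iso. a C > 0})"
    using hs_proj_in[OF Iso_subspace]
    by (intro cmat.span_sum cmat.span_scale cmat.span_base) auto
  then show "Y \<in> cmat.span (\<Union>{C\<in>Iso. a C > 0})" by (simp only: sum_positive_proj_M X)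
next
  fix Y assume "Y \<in> cmat.span (\<Union>{C\<in>Iso. a C > 0})"
  moreover have "cmat.span (\<Union>{C\<in>Iso. a C > 0}) \<subseteq> range M"
  proof (rule cmat.span_minimal)
    show "cmat.subspace (range M)" using M.subspace_image[OF cmat.subspace_UNIV] .
    show "\<Union>{C\<in>Iso. a C > 0} \<subseteq> range M"
    proof
      fix X assume "X \<in> \<Union>{C\<in>Iso. a C > 0}"
      then obtain C where C: "C \<in> Iso" "a C > 0" "X \<in> C" by blast
      have "M (cscale (complex_of_real (1 / a C)) X) = X"
        using C M_on_Iso[OF C(1,3)] by (simp add: M.scale)
      then show "X \<in> range M" by (metis rangeI)
    qed
  qed
  ultimately show "Y \<in> range M" by blast
qed

lemma range_M_LD: "range M \<subseteq> LD Ws"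
proof -
  have "\<Union>{C\<in>Iso. a C > 0} \<subseteq> LD Ws" using Iso_subset_LD by blast
  then show ?thesis unfolding range_M using LD_subspace by (rule cmat.span_minimal)
qed

text \<open>Irreducibility of V only concerns submodules inside V, so irreducibles of the range of M
  are irreducible in L^D, and the scalar of their isomorphism class there applies.\<close>

lemma M_centralizing: "centralizing G \<mu> R W"
  unfolding centralizing_def
proof
  fix C assume "C \<in> isotypics cscale (carrier G) (lact R) (range M)"
  then obtain U where U: "irred_sub cscale (carrier G) (lact R) (range M) U"
    and C: "C = iso_comp cscale (carrier G) (lact R) (range M) U"
    by (auto simp: isotypics_def)
  have irr: "irr_LD V" if "irred_sub cscale (carrier G) (lact R) (range M) V" for V
  proof -
    have inv: "invariant_sub cscale (carrier G) (lact R) (range M) V' \<longleftrightarrow> inv_LD V'"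
      if "V' \<subseteq> range M" for V'
      using that subset_trans[OF that range_M_LD] by (simp add: invariant_sub_def)
    have V: "invariant_sub cscale (carrier G) (lact R) (range M) V" "V \<noteq> {0}"
      "\<And>V'. invariant_sub cscale (carrier G) (lact R) (range M) V' \<Longrightarrow> V' \<subseteq> V \<Longrightarrow> V' = {0} \<or> V' = V"
      using that unfolding irred_sub_def by simp_all
    have sub: "V \<subseteq> range M" using V(1) by (simp add: invariant_sub_def)
    show ?thesis
      unfolding irred_sub_def
    proof (intro conjI allI impI V(2))
      show "inv_LD V" using V(1) inv[OF sub] by simp
      fix V' assume V': "inv_LD V' \<and> V' \<subseteq> V"
      then have "invariant_sub cscale (carrier G) (lact R) (range M) V'"
        using inv[OF subset_trans[OF _ sub], of V'] by simp
      then show "V' = {0} \<or> V' = V" using V(3) V' by blast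
    qed
  qed
  have "M X = cscale (complex_of_real (fixed_ratio U)) X" if "X \<in> C" for X
  proof (rule M_on_iso_class[OF irr[OF U]])
    show "\<Union>{V. irred_sub cscale (carrier G) (lact R) (range M) V \<and> g_iso U V}
        \<subseteq> \<Union>{V. irr_LD V \<and> g_iso U V}"
      using irr by blast
    show "X \<in> cmat.span (\<Union>{V. irred_sub cscale (carrier G) (lact R) (range M) V \<and> g_iso U V})"
      using that by (simp add: C iso_comp_def)
  qed
  then show "\<exists>c. \<forall>X\<in>C. M X = cscale c X" by blast
qed

text \<open>M commutes with the weighted projector of each component, which reduces the right
  inverse to the left inverse.\<close>

lemma M_sum_positive_proj:
  assumes "X \<in> range M"
  shows "M (\<Sum>C\<in>{C\<in>Iso. a C > 0}. cscale (complex_of_real (1 / a C)) (hs_proj C X)) = X"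
proof -
  obtain Y where Y: "X = M Y" using assms by blast
  have "M (cscale (complex_of_real (1 / a C)) (hs_proj C X))
      = cscale (complex_of_real (1 / a C)) (hs_proj C (M X))" if "C \<in> Iso" for C
    using hs_proj_M[OF that] M_on_Iso[OF that hs_proj_in[OF Iso_subspace[OF that]]]
    by (simp add: M.scale)
  then have "M (\<Sum>C\<in>{C\<in>Iso. a C > 0}. cscale (complex_of_real (1 / a C)) (hs_proj C X))
      = (\<Sum>C\<in>{C\<in>Iso. a C > 0}. cscale (complex_of_real (1 / a C)) (hs_proj C (M X)))"
    unfolding M.sum by (intro sum.cong) auto
  then show ?thesis using sum_positive_proj_M[of Y] Y by simp
qed

end

theorem theorem1:
  fixes G :: "('g, 'b) monoid_scheme" and T :: "'g topology" and \<mu> :: "'g measure"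
    and R :: "'g \<Rightarrow> complex^'n^'n" and H :: "'g set"
    and W :: "(complex^'n) set" and Ws :: "(complex^'n) set set"
  assumes "compact_group G T"
    and "haar_prob G T \<mu>"
    and "cont_unitary_rep G T R"
    and "subgroup H G" and "closedin T H"
    and "\<forall>x\<in>H. \<forall>y\<in>H. x \<otimes>\<^bsub>G\<^esub> y = y \<otimes>\<^bsub>G\<^esub> x"
    and "NDCSE G R H W Ws"
  defines "M \<equiv> meas_channel \<mu> R W"
    and "Iso \<equiv> isotypics cscale (carrier G) (lact R) (LD Ws)"
    and "a \<equiv> coeffH G R H Ws"
  shows "(\<forall>X. M X = (\<Sum>C\<in>Iso. cscale (complex_of_real (a C)) (hs_proj C X)))
    \<and> centralizing G \<mu> R W
    \<and> range M = module.span cscale (\<Union>{C\<in>Iso. a C > 0})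
    \<and> (\<forall>X\<in>range M.
          M (\<Sum>C\<in>{C\<in>Iso. a C > 0}. cscale (complex_of_real (1 / a C)) (hs_proj C X)) = X
        \<and> (\<Sum>C\<in>{C\<in>Iso. a C > 0}. cscale (complex_of_real (1 / a C)) (hs_proj C (M X))) = X)"
proof -
  interpret D: ndcse_rep G T \<mu> R H W Ws using assms(1-4,7) by (rule ndcse_rep.intro)
  show ?thesis
    unfolding M_def Iso_def a_def
    by (intro conjI allI ballI D.M_diagonal D.M_centralizing D.range_M D.M_sum_positive_proj)
      (auto simp only: D.sum_positive_proj_M)
qed

end
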